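(* Let $P\subseteq U$ be a $\Phi$-placed and $\Psi$-appropriate polytope. Let $\mathfrak G\mathcal R(P)$ be the poset whose underlying set is $\{(\tau,g\Phi_\tau):\ \tau\in\mathrm{FFan}(P),\ g\in\mathfrak G\}$ (a set of pairs of cones in $W$), with partial order $(\tau_1,\eta_1)\le(\tau_2,\eta_2)$ if and only if $\tau_1\subseteq\tau_2$ and there exists $g\in\mathfrak G$ with $g^{-1}\eta_1=\Phi_{\tau_1}$ and $g^{-1}\eta_2=\Phi_{\tau_2}$. Then $\mathfrak G\mathcal R(P)$ is isomorphic to the face poset of the normal fan $\Sigma(\mathfrak G(P))$ (cones ordered by inclusion). Consequently, the face poset of $\mathfrak G(P)$ is isomorphic to the dual of $\mathfrak G\mathcal R(P)$.
   Context: Setting: $\mathbb R^d$ with inner product $[\cdot,\cdot]$; $V\subseteq\mathbb R^d$ a subspace; $W=\mathbb R^d/V^\perp$; $\mathbf x_0\in V^\perp$, $U=V+\mathbf x_0$, pairing $\langle\mathbf w,\mathbf u\rangle=[\mathbf w,\mathbf u-\mathbf x_0]$, $U$ identified with $W$ via $\mathbf u\mapsto\mathbf u+V^\perp$. $\mathcal H$ is a finite set of linear hyperplanes in $W$ meeting in a single point such that the group $\mathfrak G\subseteq GL(W)$ generated by the reflections in them is finite; $\mathfrak G$ acts on $W$ on the left and on $U$ on the right via $\langle g\mathbf w,\mathbf u\rangle=\langle\mathbf w,\mathbf ug\rangle$. $\Phi$ is a fixed chamber of the fan induced by $\mathcal H$, $\Psi\subseteq U$ the corresponding cone. Interiors are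 relative interiors. $\Sigma(P)\subseteq W$ is the normal fan of a polytope $P\subseteq U$; $P^\vee$ the set of $\mathbf w\in W$ whose pairing is constant on $P$; $P$ is $\Phi$-placed if $P^\vee\cap\Phi^\circ\ne\emptyset$, $\Psi$-appropriate if $P\subseteq\Psi^\circ$. $\mathfrak G(P)=\operatorname{Conv}\{\mathbf xg:\mathbf x\in P,g\in\mathfrak G\}$; its face poset is the set of its nonempty faces under inclusion. $\mathrm{FFan}(P)$ is the set of all faces of the cones $\sigma\cap\Phi$, $\sigma\in\Sigma(P)$; for $\tau\in\mathrm{FFan}(P)$, $\Phi_\tau$ is the inclusion-minimal face of $\Phi$ containing $\tau$. (The poset $\mathfrak G\mathcal R(P)$ in the claim is the paper's "$\mathfrak G$-symmetrization of the face poset of the refined fundamental fan".)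
   Formalization: It is additionally assumed that no image gH (g in the group, H in the arrangement) meets the interior of Φ, i.e. Φ is a fundamental chamber; without this the claim fails, e.g. for two lines at 60° with Φ the 120° chamber and P a generic point. *)

theory Defs
  imports "HOL-Analysis.Analysis" "HOL-Algebra.Bij" "HOL-Algebra.Generated_Groups"
begin

text \<open>
  \<open>W\<close> is the quotient of the ambient Euclidean space by the orthogonal complement of \<open>V\<close>; its
  points are the cosets \<open>x + V\<^sup>\<bottom>\<close>.  A subset \<open>S\<close> of \<open>W\<close> is thus a set of cosets, and \<open>\<Union>S\<close> is its
  preimage under the quotient map.  Linear, convex and topological notions for subsets of \<open>W\<close> are
  read off from the preimage: the quotient map is linear, open and surjective, so that
  \<open>S \<mapsto> \<Union>S\<close> preserves and reflects subspaces (with codimension), faces and relative interiors.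
\<close>

definition qclass :: "'a::euclidean_space set \<Rightarrow> 'a \<Rightarrow> 'a set" where
  "qclass V x = (+) x ` (V\<^sup>\<bottom>)"

definition qspace :: "'a::euclidean_space set \<Rightarrow> 'a set set" where
  "qspace V = range (qclass V)"

definition dual_space :: "'a::euclidean_space set \<Rightarrow> 'a \<Rightarrow> 'a set" where
  "dual_space V x0 = (\<lambda>v. v + x0) ` V"

text \<open>For \<open>w \<in> qspace V\<close> and \<open>u \<in> dual_space V x0\<close> the value does not depend on the
  representative, because \<open>u - x0 \<in> V\<close>.\<close>

definition pairing :: "'a::euclidean_space \<Rightarrow> 'a set \<Rightarrow> 'a \<Rightarrow> real" where
  "pairing x0 w u = (SOME x. x \<in> w) \<bullet> (u - x0)"

definition qrel_interior :: "'a::euclidean_space set \<Rightarrow> 'a set set \<Rightarrow> 'a set set" where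
  "qrel_interior V S = {w \<in> qspace V. w \<subseteq> rel_interior (\<Union>S)}"

text \<open>Faces of a cone are nonempty here, whereas \<open>{}\<close> is a face for the library's \<open>face_of\<close>.\<close>

definition cone_face :: "'a::euclidean_space set set \<Rightarrow> 'a set set \<Rightarrow> bool" where
  "cone_face F C \<longleftrightarrow> F \<noteq> {} \<and> F \<subseteq> C \<and> (\<Union>F) face_of (\<Union>C)"

subsection \<open>Hyperplanes, reflections and chambers\<close>

definition linear_hyperplane :: "'a::euclidean_space set \<Rightarrow> 'a set set \<Rightarrow> bool" where
  "linear_hyperplane V H \<longleftrightarrow>
     H \<subseteq> qspace V \<and> subspace (\<Union>H) \<and> dim (\<Union>H) + 1 = DIM('a)"

definition normals :: "'a::euclidean_space set set \<Rightarrow> 'a set" where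
  "normals H = (\<Union>H)\<^sup>\<bottom> - {0}"

text \<open>The Euclidean structure of \<open>W\<close> is the one transported from \<open>V\<close> by \<open>v \<mapsto> v + V\<^sup>\<bottom>\<close>.
  A normal \<open>n\<close> of \<open>H\<close> lies in \<open>V\<close>, and the orthogonal reflection of the ambient space along \<open>n\<close>
  fixes \<open>V\<^sup>\<bottom>\<close> pointwise, hence maps cosets to cosets; it induces the orthogonal reflection of
  \<open>W\<close> in \<open>H\<close>, which does not depend on the choice of \<open>n\<close>.\<close>

definition reflection :: "'a::euclidean_space set \<Rightarrow> 'a set set \<Rightarrow> 'a set \<Rightarrow> 'a set" where
  "reflection V H =
     (\<lambda>w\<in>qspace V. let n = (SOME n. n \<in> normals H)
                   in (\<lambda>x. x - (2 * (x \<bullet> n) / (n \<bullet> n)) *\<^sub>R n) ` w)"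

definition refl_group ::
  "'a::euclidean_space set \<Rightarrow> 'a set set set \<Rightarrow> ('a set \<Rightarrow> 'a set) set" where
  "refl_group V \<H> = generate (BijGroup (qspace V)) (reflection V ` \<H>)"

definition halfspaces :: "'a::euclidean_space set \<Rightarrow> 'a set set \<Rightarrow> 'a set set set" where
  "halfspaces V H = {{w \<in> qspace V. \<forall>x\<in>w. 0 \<le> x \<bullet> n} | n. n \<in> normals H}"

text \<open>The fan induced by \<open>\<H>\<close> consists of the cones obtained by choosing, for each \<open>H \<in> \<H>\<close>,
  one of its two closed half-spaces or \<open>H\<close> itself, and intersecting; its chambers are its
  inclusion-maximal cones.\<close>

definition arrangement_fan ::
  "'a::euclidean_space set \<Rightarrow> 'a set set set \<Rightarrow> 'a set set set" where
  "arrangement_fan V \<H> =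
     {qspace V \<inter> (\<Inter>H\<in>\<H>. c H) | c. \<forall>H\<in>\<H>. c H = H \<or> c H \<in> halfspaces V H}"

definition chamber ::
  "'a::euclidean_space set \<Rightarrow> 'a set set set \<Rightarrow> 'a set set \<Rightarrow> bool" where
  "chamber V \<H> \<Phi> \<longleftrightarrow>
     \<Phi> \<in> arrangement_fan V \<H> \<and> (\<forall>C\<in>arrangement_fan V \<H>. \<Phi> \<subseteq> C \<longrightarrow> C = \<Phi>)"

definition dual_cone :: "'a::euclidean_space set \<Rightarrow> 'a \<Rightarrow> 'a set set \<Rightarrow> 'a set" where
  "dual_cone V x0 \<Phi> = {u \<in> dual_space V x0. qclass V u \<in> \<Phi>}"

subsection \<open>Right action and symmetrization of polytopes\<close>

definition right_act ::
  "'a::euclidean_space set \<Rightarrow> 'a \<Rightarrow> 'a \<Rightarrow> ('a set \<Rightarrow> 'a set) \<Rightarrow> 'a" where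
  "right_act V x0 u g =
     (THE u'. u' \<in> dual_space V x0 \<and> (\<forall>w\<in>qspace V. pairing x0 (g w) u = pairing x0 w u'))"

definition symmetrization ::
  "'a::euclidean_space set \<Rightarrow> 'a \<Rightarrow> 'a set set set \<Rightarrow> 'a set \<Rightarrow> 'a set" where
  "symmetrization V x0 \<H> P = convex hull {right_act V x0 x g | x g. x \<in> P \<and> g \<in> refl_group V \<H>}"

subsection \<open>Normal fans\<close>

text \<open>Outer normal cones: the functionals attaining their maximum over \<open>P\<close> on \<open>F\<close>.\<close>

definition normal_cone ::
  "'a::euclidean_space set \<Rightarrow> 'a \<Rightarrow> 'a set \<Rightarrow> 'a set \<Rightarrow> 'a set set" where
  "normal_cone V x0 P F =
     {w \<in> qspace V. \<forall>u\<in>F. \<forall>u'\<in>P. pairing x0 w u' \<le> pairing x0 w u}"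

definition nonempty_faces :: "'a::euclidean_space set \<Rightarrow> 'a set set" where
  "nonempty_faces P = {F. F face_of P \<and> F \<noteq> {}}"

definition normal_fan ::
  "'a::euclidean_space set \<Rightarrow> 'a \<Rightarrow> 'a set \<Rightarrow> 'a set set set" where
  "normal_fan V x0 P = normal_cone V x0 P ` nonempty_faces P"

definition const_functionals ::
  "'a::euclidean_space set \<Rightarrow> 'a \<Rightarrow> 'a set \<Rightarrow> 'a set set" where
  "const_functionals V x0 P =
     {w \<in> qspace V. \<forall>u\<in>P. \<forall>u'\<in>P. pairing x0 w u = pairing x0 w u'}"

definition placed ::
  "'a::euclidean_space set \<Rightarrow> 'a \<Rightarrow> 'a set set \<Rightarrow> 'a set \<Rightarrow> bool" where
  "placed V x0 \<Phi> P \<longleftrightarrow> const_functionals V x0 P \<inter> qrel_interior V \<Phi> \<noteq> {}"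

definition appropriate ::
  "'a::euclidean_space set \<Rightarrow> 'a set \<Rightarrow> bool" where
  "appropriate \<Psi> P \<longleftrightarrow> P \<subseteq> rel_interior \<Psi>"

subsection \<open>The refined fundamental fan and its symmetrization\<close>

definition FFan ::
  "'a::euclidean_space set \<Rightarrow> 'a \<Rightarrow> 'a set set \<Rightarrow> 'a set \<Rightarrow> 'a set set set" where
  "FFan V x0 \<Phi> P = {\<tau>. \<exists>\<sigma>\<in>normal_fan V x0 P. cone_face \<tau> (\<sigma> \<inter> \<Phi>)}"

definition min_face ::
  "'a::euclidean_space set set \<Rightarrow> 'a set set \<Rightarrow> 'a set set" where
  "min_face \<Phi> \<tau> = (LEAST F. cone_face F \<Phi> \<and> \<tau> \<subseteq> F)"

definition GR ::
  "'a::euclidean_space set \<Rightarrow> 'a \<Rightarrow> 'a set set set \<Rightarrow> 'a set set \<Rightarrow> 'a set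
     \<Rightarrow> ('a set set \<times> 'a set set) set" where
  "GR V x0 \<H> \<Phi> P =
     {(\<tau>, g ` min_face \<Phi> \<tau>) | \<tau> g. \<tau> \<in> FFan V x0 \<Phi> P \<and> g \<in> refl_group V \<H>}"

definition GR_le ::
  "'a::euclidean_space set \<Rightarrow> 'a set set set \<Rightarrow> 'a set set
     \<Rightarrow> 'a set set \<times> 'a set set \<Rightarrow> 'a set set \<times> 'a set set \<Rightarrow> bool" where
  "GR_le V \<H> \<Phi> p q \<longleftrightarrow>
     fst p \<subseteq> fst q \<and>
     (\<exists>g\<in>refl_group V \<H>.
        (inv\<^bsub>BijGroup (qspace V)\<^esub> g) ` snd p = min_face \<Phi> (fst p) \<and>
        (inv\<^bsub>BijGroup (qspace V)\<^esub> g) ` snd q = min_face \<Phi> (fst q))"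

definition poset_isomorphic ::
  "'b set \<Rightarrow> ('b \<Rightarrow> 'b \<Rightarrow> bool) \<Rightarrow> 'c set \<Rightarrow> ('c \<Rightarrow> 'c \<Rightarrow> bool) \<Rightarrow> bool" where
  "poset_isomorphic A le_A B le_B \<longleftrightarrow>
     (\<exists>f. bij_betw f A B \<and> (\<forall>x\<in>A. \<forall>y\<in>A. le_A x y \<longleftrightarrow> le_B (f x) (f y)))"

end

theory Submission
  imports Defs
begin

text \<open>
  Work in the ambient space with the preimages of all cones, and let \<open>C\<close> be the preimage of
  \<open>\<Phi>\<close>. For \<open>w\<close> in \<open>C\<close>, \<open>g\<close> in the group and \<open>u\<close> interior to \<open>C\<close> one has
  \<open>g w \<bullet> u \<le> w \<bullet> u\<close>, and equality forces \<open>g\<close> to fix pointwise the minimal face of \<open>C\<close> containing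
  \<open>w\<close>. As the polytope \<open>P\<close> (translated by \<open>- x0\<close>) lies in the interior of \<open>C\<close>, the face of its
  symmetrization on which \<open>w\<close> is maximal is spanned by the images of the corresponding face of
  \<open>P\<close> under the stabilizer of \<open>w\<close>. Hence the normal cone at that face consists of the \<open>y\<close> in the
  minimal face of \<open>C\<close> containing \<open>w\<close> such that every point of \<open>P\<close> maximizing \<open>w\<close> also maximizes
  \<open>y\<close>; these are exactly the cones of the refined fundamental fan. The normal fan of the
  symmetrization is therefore the set of all \<open>g \<tau>\<close>, and \<open>(\<tau>, g \<Phi>\<^sub>\<tau>) \<mapsto> g \<tau>\<close> is the isomorphism:
  \<open>C\<close> is a strict fundamental domain and an element fixing a relative interior point of \<open>\<tau>\<close> fixes
  \<open>\<Phi>\<^sub>\<tau>\<close> pointwise.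
\<close>

subsection \<open>Finite reflection groups\<close>

text \<open>The hyperplanes in \<H> generate the group but need not include all its mirrors: two
  lines in the plane at angle 2 pi / 5 generate a dihedral group of order 10, whose fundamental
  domains have angle pi / 5. That images of hyperplanes miss the interior of \<Phi> is what makes
  \<Phi> a single fundamental domain. It enters as \<open>regular\<close>, and through it every root
  keeps its sign on the open chamber. The inequality comes from writing group elements as words in
  reflections at facets of \<open>C\<close>: a last letter either subtracts a nonnegative multiple
  of a root positive at \<open>u\<close>, or can be deleted. Cones are handled through points. A
  point \<open>w\<close> stands for the cone having it in its relative interior, so that faces,
  minimal faces and normal cones turn into statements about which of finitely many linear
  inequalities are tight at \<open>w\<close>. Pairs \<open>(g, w)\<close> then index both posets,
  with many repetitions; the isomorphism is therefore read off from the equivalence of the two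
  orders and antisymmetry.\<close>

definition hrefl :: "'a::euclidean_space \<Rightarrow> 'a \<Rightarrow> 'a" where
  "hrefl a x = x - (2 * (x \<bullet> a) / (a \<bullet> a)) *\<^sub>R a"

text \<open>Words rather than an abstract generated subgroup: the exchange argument needs induction
  on length and deletion of a letter.\<close>

fun hrefl_word :: "'a::euclidean_space list \<Rightarrow> 'a \<Rightarrow> 'a" where
  "hrefl_word [] = id"
| "hrefl_word (a # as) = hrefl a \<circ> hrefl_word as"

text \<open>Since x / 0 = 0, \<open>hrefl 0\<close> is the identity, so the basic identities hold
  for a = 0 too.\<close>

lemma hrefl_inner: "hrefl a x \<bullet> hrefl a y = x \<bullet> y"
  by (cases "a = 0") (simp_all add: hrefl_def inner_diff inner_commute algebra_simps)

lemma linear_hrefl: "linear (hrefl a)"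
  by (rule linearI) (simp_all add: hrefl_def inner_add_left algebra_simps add_divide_distrib)

lemma hrefl_hrefl [simp]: "hrefl a (hrefl a x) = x"
  by (cases "a = 0") (simp_all add: hrefl_def inner_diff_left algebra_simps)

lemma hrefl_self: "hrefl a a = - a"
  by (cases "a = 0") (simp_all add: hrefl_def scaleR_2)

lemma hrefl_scaleR: "c \<noteq> 0 \<Longrightarrow> hrefl (c *\<^sub>R a) = hrefl a"
  by (rule ext) (simp add: hrefl_def)

lemma hrefl_orthogonal: "a \<bullet> x = 0 \<Longrightarrow> hrefl a x = x"
  by (simp add: hrefl_def inner_commute)

lemma orthogonal_transformation_hrefl: "orthogonal_transformation (hrefl a)"
  by (simp add: orthogonal_transformation_def linear_hrefl hrefl_inner)

lemma orthogonal_transformation_hrefl_word: "orthogonal_transformation (hrefl_word as)"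
proof (induction as)
  case Nil
  then show ?case by (simp add: id_def)
next
  case (Cons a as)
  then show ?case
    unfolding hrefl_word.simps
    by (rule orthogonal_transformation_compose[OF orthogonal_transformation_hrefl])
qed

text \<open>The coefficient in \<open>hrefl\<close> is built from inner products, which
  \<open>f\<close> preserves. It serves to move a reflection past a word at the price of replacing
  its root by the image.\<close>

lemma orthogonal_transformation_conj_hrefl:
  assumes "orthogonal_transformation f"
  shows "f (hrefl a x) = hrefl (f a) (f x)"
proof -
  have "linear f" "\<And>x y. f x \<bullet> f y = x \<bullet> y"
    using assms by (auto simp: orthogonal_transformation_def)
  then show ?thesis
    by (simp add: hrefl_def linear_diff linear_scale)
qed

lemma hrefl_word_append: "hrefl_word (as @ bs) = hrefl_word as \<circ> hrefl_word bs"
  by (induction as) (auto simp: comp_assoc)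

lemma hrefl_word_rev: "hrefl_word (rev as) (hrefl_word as x) = x"
  by (induction as arbitrary: x) (auto simp: hrefl_word_append)

text \<open>Finitely many hyperplanes form a null set, which cannot cover a nonempty open set. Three
  choices rest on it: the start of the segment in \<open>simples_separate\<close>, the point on a
  single mirror in \<open>hrefl_simple_word\<close>, and the perturbation in
  \<open>chamber_normals\<close>.\<close>

lemma generic_point:
  fixes B :: "'a::euclidean_space set"
  assumes "finite B" "0 \<notin> B" "open U" "U \<noteq> {}"
  obtains u where "u \<in> U" "\<And>b. b \<in> B \<Longrightarrow> b \<bullet> u \<noteq> 0"
proof -
  have "negligible (\<Union>b\<in>B. {x. b \<bullet> x = 0})"
    using assms by (intro negligible_Union) (auto intro!: negligible_hyperplane)
  moreover have "\<not> negligible U"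
    using assms open_not_negligible by blast
  ultimately have "\<not> U \<subseteq> (\<Union>b\<in>B. {x. b \<bullet> x = 0})"
    using negligible_subset by blast
  then show thesis
    using that by blast
qed

text \<open>\<open>N\<close> holds the unit normals of all given hyperplanes, oriented towards
  \<open>c\<close>; not each of them need bound a facet of the chamber. Unit length makes roots on
  one ray equal. \<open>regular\<close> says that no mirror obtained from \<open>N\<close> by the
  group cuts the open chamber.\<close>

locale finite_reflections =
  fixes N :: "'a::euclidean_space set" and c :: 'a
  assumes finite_N: "finite N"
    and norm_N: "n \<in> N \<Longrightarrow> norm n = 1"
    and finite_group: "finite (hrefl_word ` lists N)"
    and c_pos: "n \<in> N \<Longrightarrow> 0 < n \<bullet> c"
    and regular: "g \<in> hrefl_word ` lists N \<Longrightarrow> n \<in> N \<Longrightarrow> (\<And>m. m \<in> N \<Longrightarrow> 0 < m \<bullet> x) \<Longrightarrow> g n \<bullet> x \<noteq> 0"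
begin

definition G :: "('a \<Rightarrow> 'a) set" where "G = hrefl_word ` lists N"

definition C :: "'a set" where "C = {x. \<forall>n\<in>N. 0 \<le> n \<bullet> x}"

definition reg :: "'a set" where "reg = {x. \<forall>n\<in>N. 0 < n \<bullet> x}"

definition roots :: "'a set" where "roots = {g n | g n. g \<in> G \<and> n \<in> N}"

definition pos :: "'a set" where "pos = {a \<in> roots. 0 < a \<bullet> c}"

definition simples :: "'a set" where
  "simples = {a \<in> pos. \<exists>p\<in>C. a \<bullet> p = 0 \<and> (\<forall>b\<in>pos - {a}. 0 < b \<bullet> p)}"

lemma finite_G: "finite G"
  using finite_group by (simp add: G_def)

lemma G_orth: "g \<in> G \<Longrightarrow> orthogonal_transformation g"
  using orthogonal_transformation_hrefl_word by (auto simp: G_def)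

lemma G_linear: "g \<in> G \<Longrightarrow> linear g"
  using G_orth orthogonal_transformation_linear by blast

lemma G_inner: "g \<in> G \<Longrightarrow> g x \<bullet> g y = x \<bullet> y"
  using G_orth orthogonal_transformation_def by blast

lemma G_id: "id \<in> G"
  unfolding G_def by (rule image_eqI[of _ _ "[]"]) auto

lemma G_hrefl: "n \<in> N \<Longrightarrow> hrefl n \<in> G"
  unfolding G_def by (rule image_eqI[of _ _ "[n]"]) auto

lemma G_comp:
  assumes "g \<in> G" "h \<in> G" shows "g \<circ> h \<in> G"
proof -
  obtain as bs where "as \<in> lists N" "bs \<in> lists N" "g = hrefl_word as" "h = hrefl_word bs"
    using assms by (auto simp: G_def)
  then show ?thesis
    unfolding G_def by (intro image_eqI[of _ _ "as @ bs"]) (auto simp: hrefl_word_append)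
qed

lemma G_inv:
  assumes "g \<in> G"
  obtains h where "h \<in> G" "\<And>x. h (g x) = x" "\<And>x. g (h x) = x"
proof -
  obtain as where as: "as \<in> lists N" "g = hrefl_word as"
    using assms by (auto simp: G_def)
  show thesis
  proof (rule that[of "hrefl_word (rev as)"])
    show "hrefl_word (rev as) \<in> G"
      unfolding G_def using as by (intro imageI) auto
    show "hrefl_word (rev as) (g x) = x" for x
      by (simp add: as hrefl_word_rev)
    show "g (hrefl_word (rev as) x) = x" for x
      using hrefl_word_rev[of "rev as"] by (simp add: as)
  qed
qed

section \<open>Roots and their signs on the open chamber\<close>

lemma N_subset_roots: "N \<subseteq> roots"
proof
  fix n assume "n \<in> N"
  then have "n = id n" "id \<in> G" "n \<in> N"
    using G_id by auto
  then show "n \<in> roots"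
    unfolding roots_def by blast
qed

lemma finite_roots: "finite roots"
proof -
  have "roots = (\<lambda>(g, n). g n) ` (G \<times> N)"
    by (auto simp: roots_def)
  then show ?thesis
    using finite_G finite_N by simp
qed

lemma finite_pos: "finite pos"
  using finite_roots by (simp add: pos_def)

lemma G_roots: "g \<in> G \<Longrightarrow> a \<in> roots \<Longrightarrow> g a \<in> roots"
proof -
  assume g: "g \<in> G" and "a \<in> roots"
  then obtain h n where h: "h \<in> G" "n \<in> N" "a = h n"
    by (auto simp: roots_def)
  then have "g a = (g \<circ> h) n"
    by simp
  then show ?thesis
    unfolding roots_def using G_comp[OF g h(1)] h by blast
qed

lemma roots_uminus:
  assumes "a \<in> roots" shows "- a \<in> roots"
proof -
  obtain g n where gn: "g \<in> G" "n \<in> N" "a = g n"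
    using assms by (auto simp: roots_def)
  have "- a = (g \<circ> hrefl n) n"
    using linear_neg[OF G_linear[OF gn(1)]] gn by (simp add: hrefl_self)
  then show ?thesis
    unfolding roots_def using gn G_comp[OF gn(1) G_hrefl[OF gn(2)]] by blast
qed

lemma roots_norm: "a \<in> roots \<Longrightarrow> norm a = 1"
  using G_orth norm_N by (auto simp: roots_def orthogonal_transformation_norm)

lemma roots_hrefl:
  assumes "a \<in> roots" shows "hrefl a \<in> G"
proof -
  obtain g n where gn: "g \<in> G" "n \<in> N" "a = g n"
    using assms by (auto simp: roots_def)
  obtain h where h: "h \<in> G" "\<And>x. h (g x) = x" "\<And>x. g (h x) = x"
    using G_inv gn by blast
  have "hrefl a x = g (hrefl n (h x))" for x
    using orthogonal_transformation_conj_hrefl[OF G_orth, of g n "h x"] gn h by simp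
  then have "hrefl a = g \<circ> hrefl n \<circ> h"
    by auto
  then show ?thesis
    using gn h G_comp G_hrefl by simp
qed

lemma c_reg: "c \<in> reg"
  using c_pos by (auto simp: reg_def)

lemma roots_reg: "a \<in> roots \<Longrightarrow> x \<in> reg \<Longrightarrow> a \<bullet> x \<noteq> 0"
proof -
  assume a: "a \<in> roots" and x: "x \<in> reg"
  then obtain g n where gn: "g \<in> G" "n \<in> N" "a = g n"
    by (auto simp: roots_def)
  have "g n \<bullet> x \<noteq> 0"
    by (rule regular[of g n x]) (use gn x in \<open>auto simp: G_def reg_def\<close>)
  then show ?thesis
    by (simp add: gn)
qed

lemma N_subset_pos: "N \<subseteq> pos"
  using N_subset_roots c_pos by (auto simp: pos_def)

lemma pos_roots: "a \<in> pos \<Longrightarrow> a \<in> roots"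
  by (simp add: pos_def)

lemma roots_cases: "a \<in> roots \<Longrightarrow> a \<in> pos \<or> - a \<in> pos"
  using roots_reg[OF _ c_reg, of a] roots_uminus[of a] by (auto simp: pos_def)

lemma convex_reg: "convex reg"
proof -
  have "reg = (\<Inter>n\<in>N. {x. n \<bullet> x > 0})"
    by (auto simp: reg_def)
  then show ?thesis
    by (simp add: convex_INT convex_halfspace_gt)
qed

lemma open_reg: "open reg"
proof -
  have "reg = (\<Inter>n\<in>N. {x. n \<bullet> x > 0})"
    by (auto simp: reg_def)
  then show ?thesis
    using finite_N by (simp add: open_INT open_halfspace_gt)
qed

text \<open>A root with different signs at \<open>c\<close> and \<open>x\<close> would vanish
  somewhere on the segment between them, which stays in the convex set \<open>reg\<close>; the
  parameter \<open>t\<close> is that zero.\<close>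

lemma pos_reg:
  assumes "a \<in> pos" "x \<in> reg" shows "0 < a \<bullet> x"
proof (rule ccontr)
  assume "\<not> 0 < a \<bullet> x"
  with roots_reg assms pos_roots have neg: "a \<bullet> x < 0"
    by (meson linorder_cases)
  have c: "0 < a \<bullet> c"
    using assms by (simp add: pos_def)
  define t where "t = (a \<bullet> c) / (a \<bullet> c - a \<bullet> x)"
  have t: "0 \<le> t" "t \<le> 1"
    using neg c by (auto simp: t_def field_simps)
  have "(1 - t) *\<^sub>R c + t *\<^sub>R x \<in> reg"
    using convexD[OF convex_reg c_reg assms(2), of "1 - t" t] t by simp
  moreover have "a \<bullet> ((1 - t) *\<^sub>R c + t *\<^sub>R x) = a \<bullet> c - t * (a \<bullet> c - a \<bullet> x)"
    by (simp add: inner_add_right algebra_simps)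
  moreover have "\<dots> = 0"
    using neg c by (simp add: t_def)
  ultimately show False
    using roots_reg assms pos_roots by metis
qed

text \<open>A negative value at \<open>x\<close> could be cancelled by adding a positive multiple of
  \<open>c\<close>. This moves \<open>x\<close> into \<open>reg\<close>, where no root
  vanishes.\<close>

lemma pos_C:
  assumes "a \<in> pos" "x \<in> C" shows "0 \<le> a \<bullet> x"
proof (rule ccontr)
  assume neg: "\<not> 0 \<le> a \<bullet> x"
  have c: "0 < a \<bullet> c"
    using assms by (simp add: pos_def)
  define e where "e = - (a \<bullet> x) / (a \<bullet> c)"
  have "0 < e"
    using neg c by (auto simp: e_def divide_neg_pos)
  then have "x + e *\<^sub>R c \<in> reg"
    using assms c_pos by (auto simp: reg_def C_def inner_add_right intro: add_nonneg_pos)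
  moreover have "a \<bullet> (x + e *\<^sub>R c) = 0"
    using c by (simp add: e_def inner_add_right inner_diff_right)
  ultimately show False
    using roots_reg assms pos_roots by metis
qed

lemma C_iff_pos: "x \<in> C \<longleftrightarrow> (\<forall>a\<in>pos. 0 \<le> a \<bullet> x)"
  using pos_C N_subset_pos by (auto simp: C_def)

section \<open>Simple roots and the facets of the chamber\<close>

lemma simples_pos: "a \<in> simples \<Longrightarrow> a \<in> pos"
  by (simp add: simples_def)

text \<open>Unit roots on the same line are opposite, so distinct positive roots are never parallel.\<close>

lemma pos_not_parallel:
  assumes "a \<in> pos" "b \<in> pos" "s *\<^sub>R a = t *\<^sub>R b" "0 < s" "0 < t"
  shows "a = b"
proof -
  have "norm (s *\<^sub>R a) = norm (t *\<^sub>R b)"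
    using assms by simp
  then have "s = t"
    using assms(4,5) roots_norm[OF pos_roots[OF assms(1)]] roots_norm[OF pos_roots[OF assms(2)]]
    by simp
  then show ?thesis
    using assms by simp
qed

text \<open>\<open>hrefl a\<close> fixes the facet point \<open>p\<close>, so the image of
  \<open>b\<close> keeps the strictly positive value of \<open>b\<close> at \<open>p\<close> and its
  negative cannot be a positive root.\<close>

lemma hrefl_pos:
  assumes "a \<in> simples" "b \<in> pos" "b \<noteq> a" shows "hrefl a b \<in> pos"
proof -
  obtain p where p: "p \<in> C" "a \<bullet> p = 0" "\<And>b. b \<in> pos - {a} \<Longrightarrow> 0 < b \<bullet> p"
    using assms by (auto simp: simples_def)
  have "hrefl a b \<in> roots"
    using assms G_roots roots_hrefl pos_roots simples_pos by blast
  moreover have "hrefl a b \<bullet> p = b \<bullet> p"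
    using hrefl_inner[of a b p] hrefl_orthogonal[OF p(2)] by simp
  then have "- hrefl a b \<notin> pos"
    using p assms pos_C[of "- hrefl a b" p] by force
  ultimately show ?thesis
    using roots_cases by blast
qed

text \<open>The segment to \<open>x\<close> from a generic interior point of \<open>C\<close> leaves \<open>C\<close> through a point lying on
  exactly one of the hyperplanes; the corresponding root is simple.\<close>

lemma simples_separate:
  assumes "x \<notin> C"
  obtains a where "a \<in> simples" "a \<bullet> x < 0"
proof -
  define M where "M = {a \<in> pos. a \<bullet> x < 0}"
  have fin: "finite M"
    using finite_pos by (simp add: M_def)
  have "M \<noteq> {}"
    using assms by (auto simp: C_iff_pos M_def not_le)
  \<comment> \<open>Orthogonality of \<open>u\<close> to one of these vectors means that two roots
    vanish at the same point of the segment from \<open>u\<close> to \<open>x\<close>. Avoiding them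
    all makes the mirrors be crossed one at a time.\<close>
  define B where "B = {(a \<bullet> x) *\<^sub>R b - (b \<bullet> x) *\<^sub>R a | a b. a \<in> M \<and> b \<in> M \<and> a \<noteq> b}"
  have "B \<subseteq> (\<lambda>(a, b). (a \<bullet> x) *\<^sub>R b - (b \<bullet> x) *\<^sub>R a) ` (M \<times> M)"
    by (auto simp: B_def)
  then have "finite B"
    using fin finite_subset by blast
  moreover have "0 \<notin> B"
  proof
    assume "0 \<in> B"
    then obtain a b where ab: "a \<in> M" "b \<in> M" "a \<noteq> b" "(a \<bullet> x) *\<^sub>R b = (b \<bullet> x) *\<^sub>R a"
      by (auto simp: B_def)
    then have "(- (a \<bullet> x)) *\<^sub>R b = (- (b \<bullet> x)) *\<^sub>R a"
      by simp
    moreover have "0 < - (a \<bullet> x)" "0 < - (b \<bullet> x)" "a \<in> pos" "b \<in> pos"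
      using ab by (auto simp: M_def)
    ultimately show False
      using pos_not_parallel[of b a] ab(3) by blast
  qed
  ultimately obtain u where u: "u \<in> reg" "\<And>b. b \<in> B \<Longrightarrow> b \<bullet> u \<noteq> 0"
    using generic_point open_reg c_reg by (metis empty_iff)
  \<comment> \<open>The parameter at which \<open>a\<close> vanishes on the segment; its minimum
    over \<open>M\<close> marks the first mirror crossed.\<close>
  define T where "T a = (a \<bullet> u) / (a \<bullet> u - a \<bullet> x)" for a
  obtain a where a: "a \<in> M" "\<And>b. b \<in> M \<Longrightarrow> T a \<le> T b"
    using arg_min_if_finite[OF fin \<open>M \<noteq> {}\<close>, of T] by (metis not_le)
  have aM: "a \<in> pos" "a \<bullet> x < 0" "0 < a \<bullet> u"
    using a pos_reg u by (auto simp: M_def)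
  define t where "t = T a"
  have t: "0 < t" "t < 1"
    using aM by (auto simp: t_def T_def field_simps)
  define p where "p = (1 - t) *\<^sub>R u + t *\<^sub>R x"
  have ip: "b \<bullet> p = b \<bullet> u - t * (b \<bullet> u - b \<bullet> x)" for b
    by (simp add: p_def inner_add_right algebra_simps)
  have ap: "a \<bullet> p = 0"
    using aM by (simp add: ip t_def T_def)
  have "0 < b \<bullet> p" if b: "b \<in> pos" "b \<noteq> a" for b
  proof (cases "b \<in> M")
    case False
    then have "0 \<le> b \<bullet> x" "0 < b \<bullet> u"
      using b pos_reg u by (auto simp: M_def)
    moreover have "b \<bullet> p = (1 - t) * (b \<bullet> u) + t * (b \<bullet> x)"
      by (simp add: p_def inner_add_right)
    ultimately show ?thesis
      using t by (simp add: add_pos_nonneg)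
  next
    case True
    then have bM: "b \<bullet> x < 0" "0 < b \<bullet> u"
      using b pos_reg u by (auto simp: M_def)
    have "T a \<noteq> T b"
    proof
      assume "T a = T b"
      then have "((a \<bullet> x) *\<^sub>R b - (b \<bullet> x) *\<^sub>R a) \<bullet> u = 0"
        using aM bM by (simp add: T_def field_simps inner_diff_left)
      moreover have "(a \<bullet> x) *\<^sub>R b - (b \<bullet> x) *\<^sub>R a \<in> B"
        using True a b by (auto simp: B_def)
      ultimately show False
        using u by blast
    qed
    then have "t < T b"
      using a(2)[OF True] by (simp add: t_def)
    then have "t * (b \<bullet> u - b \<bullet> x) < b \<bullet> u"
      using bM by (simp add: T_def field_simps)
    then show ?thesis
      by (simp add: ip)
  qed
  moreover from this have "p \<in> C"
    using ap by (auto simp: C_iff_pos) (metis less_imp_le order_refl)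
  ultimately have "a \<in> simples"
    using aM ap by (auto simp: simples_def)
  then show thesis
    using that aM by blast
qed

lemma C_if_simples: "(\<And>a. a \<in> simples \<Longrightarrow> 0 \<le> a \<bullet> x) \<Longrightarrow> x \<in> C"
  by (meson simples_separate not_le)

section \<open>Words in simple reflections and the exchange property\<close>

lemma simple_word_G: "as \<in> lists simples \<Longrightarrow> hrefl_word as \<in> G"
proof (induction as)
  case Nil
  then show ?case using G_id by (simp add: id_def)
next
  case (Cons a as)
  then have "hrefl a \<in> G" "hrefl_word as \<in> G"
    using roots_hrefl pos_roots simples_pos by auto
  then show ?case
    unfolding hrefl_word.simps by (rule G_comp)
qed

text \<open>A point maximizing the inner product with \<open>c\<close> over a finite orbit lies in \<open>C\<close>, since
  reflecting it in a violated wall would increase that product.\<close>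

lemma simple_word_into_C:
  obtains as where "as \<in> lists simples" "hrefl_word as y \<in> C"
proof -
  define S where "S = hrefl_word ` lists simples"
  have "S \<subseteq> G"
    using simple_word_G by (auto simp: S_def)
  then have fin: "finite S"
    using finite_G finite_subset by blast
  have "S \<noteq> {}"
    by (auto simp: S_def)
  obtain g where g: "g \<in> S" "\<And>h. h \<in> S \<Longrightarrow> h y \<bullet> c \<le> g y \<bullet> c"
    using arg_min_if_finite[OF fin \<open>S \<noteq> {}\<close>, of "\<lambda>g. - (g y \<bullet> c)"]
    by (metis neg_less_iff_less not_le)
  obtain as where as: "as \<in> lists simples" "g = hrefl_word as"
    using g by (auto simp: S_def)
  have "0 \<le> a \<bullet> g y" if a: "a \<in> simples" for a
  proof (rule ccontr)
    assume neg: "\<not> 0 \<le> a \<bullet> g y"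
    have "hrefl a \<circ> g \<in> S"
      unfolding S_def using as a by (intro image_eqI[of _ _ "a # as"]) auto
    then have "hrefl a (g y) \<bullet> c \<le> g y \<bullet> c"
      using g by fastforce
    moreover have "0 < a \<bullet> c"
      using simples_pos[OF a] by (simp add: pos_def)
    moreover have aa: "a \<bullet> a = 1"
      using roots_norm[OF pos_roots[OF simples_pos[OF a]]] by (simp add: dot_square_norm)
    moreover have "hrefl a (g y) \<bullet> c = g y \<bullet> c - 2 * (a \<bullet> g y) * (a \<bullet> c)"
      by (simp add: hrefl_def aa inner_diff_left inner_commute[of "g y" a])
    moreover have "(a \<bullet> g y) * (a \<bullet> c) < 0"
      using neg calculation(2) by (simp add: mult_neg_pos)
    ultimately show False
      by linarith
  qed
  then show thesis
    using that as C_if_simples by blast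
qed

text \<open>Applying the letters one after the other to the positive root \<open>a\<close> ends
  outside \<open>pos\<close>. At the letter \<open>b\<close> where positivity is lost, the current
  root must be \<open>b\<close> itself by \<open>hrefl_pos\<close>. Conjugation then turns
  \<open>hrefl a\<close> into \<open>hrefl b\<close> at that place, and the two cancel. The word is
  not assumed reduced.\<close>

lemma exchange:
  assumes "as \<in> lists simples" "a \<in> simples" "hrefl_word as a \<notin> pos"
  obtains bs where "bs \<in> lists simples" "length as = Suc (length bs)"
    "hrefl_word as \<circ> hrefl a = hrefl_word bs"
proof -
  have "\<exists>bs\<in>lists simples. length as = Suc (length bs) \<and> hrefl_word as \<circ> hrefl a = hrefl_word bs"
    using assms(1,3)
  proof (induction as)
    case Nil
    then show ?case
      using assms simples_pos by simp
  next
    case (Cons b es)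
    let ?r = "hrefl_word es a"
    show ?case
    proof (cases "?r \<in> pos")
      case False
      then obtain bs where bs: "bs\<in>lists simples" "length es = Suc (length bs)"
          "hrefl_word es \<circ> hrefl a = hrefl_word bs"
        using Cons.IH[OF False] by blast
      show ?thesis
      proof (intro bexI conjI)
        show "b # bs \<in> lists simples"
          using Cons.hyps bs(1) by simp
        show "length (b # es) = Suc (length (b # bs))"
          using bs(2) by simp
        show "hrefl_word (b # es) \<circ> hrefl a = hrefl_word (b # bs)"
          using bs(3) by (simp add: comp_assoc)
      qed
    next
      case True
      then have "?r = b"
        using Cons.prems Cons.hyps hrefl_pos[of b ?r] by auto
      then have "hrefl_word es (hrefl a x) = hrefl b (hrefl_word es x)" for x
        using orthogonal_transformation_conj_hrefl[OF orthogonal_transformation_hrefl_word] by metis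
      then show ?thesis
        using Cons.hyps by (intro bexI[of _ es]) auto
    qed
  qed
  then show thesis
    using that by blast
qed

text \<open>Induction on the length of the word: a last letter whose root is sent to a negative one can be
  removed by exchange, any other one only decreases the inner product.\<close>

lemma simple_word_inner_le:
  assumes "as \<in> lists simples" "w \<in> C" "u \<in> reg"
  shows "hrefl_word as w \<bullet> u \<le> w \<bullet> u \<and>
    (hrefl_word as w \<bullet> u = w \<bullet> u \<longrightarrow>
      (\<forall>y. (\<forall>a\<in>pos. a \<bullet> w = 0 \<longrightarrow> a \<bullet> y = 0) \<longrightarrow> hrefl_word as y = y))"
  using assms(1)
proof (induction as rule: length_induct)
  case (1 as)
  show ?case
  proof (cases as rule: rev_cases)
    case Nil
    then show ?thesis by simp
  next
    case (snoc es a)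
    have es: "es \<in> lists simples" "a \<in> simples"
      using 1 snoc by auto
    have as: "hrefl_word as = hrefl_word es \<circ> hrefl a"
      by (simp add: snoc hrefl_word_append)
    show ?thesis
    proof (cases "hrefl_word es a \<in> pos")
      case False
      then obtain bs where "bs \<in> lists simples" "length es = Suc (length bs)"
          "hrefl_word es \<circ> hrefl a = hrefl_word bs"
        using exchange[OF es] by blast
      then show ?thesis
        using 1 as snoc by simp
    next
      case True
      have a: "0 < hrefl_word es a \<bullet> u"
        using True assms pos_reg by blast
      have w: "0 \<le> a \<bullet> w"
        using assms pos_C es simples_pos by blast
      have aa: "a \<bullet> a = 1"
        using roots_norm es simples_pos pos_roots by (simp add: dot_square_norm)
      have lin: "linear (hrefl_word es)"
        using orthogonal_transformation_linear orthogonal_transformation_hrefl_word by blast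
      \<comment> \<open>Linearity applied to \<open>hrefl a w\<close>; the subtracted term is a
        product of two nonnegative factors, the second one positive.\<close>
      have eq: "hrefl_word as w \<bullet> u = hrefl_word es w \<bullet> u - 2 * (a \<bullet> w) * (hrefl_word es a \<bullet> u)"
        unfolding as comp_apply hrefl_def aa linear_diff[OF lin] linear_scale[OF lin]
        by (simp add: inner_diff_left inner_commute[of w a])
      have "length es < length as"
        by (simp add: snoc)
      then have *: "hrefl_word es w \<bullet> u \<le> w \<bullet> u \<and> (hrefl_word es w \<bullet> u = w \<bullet> u \<longrightarrow>
          (\<forall>y. (\<forall>a\<in>pos. a \<bullet> w = 0 \<longrightarrow> a \<bullet> y = 0) \<longrightarrow> hrefl_word es y = y))"
        using 1(1) es(1) by blast
      then have IH: "hrefl_word es w \<bullet> u \<le> w \<bullet> u" "hrefl_word es w \<bullet> u = w \<bullet> u \<Longrightarrow>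
          (\<forall>a\<in>pos. a \<bullet> w = 0 \<longrightarrow> a \<bullet> y = 0) \<Longrightarrow> hrefl_word es y = y" for y
        by blast+
      have nn: "0 \<le> 2 * (a \<bullet> w) * (hrefl_word es a \<bullet> u)"
        using a w by simp
      have "hrefl_word as y = y" if eq2: "hrefl_word as w \<bullet> u = w \<bullet> u"
        and y: "\<forall>a\<in>pos. a \<bullet> w = 0 \<longrightarrow> a \<bullet> y = 0" for y
      proof -
        \<comment> \<open>Equality leaves no room for the subtracted term, whose factor
          \<open>hrefl_word es a \<bullet> u\<close> is positive. So \<open>a\<close> is tight at
          \<open>w\<close>, hence at \<open>y\<close>, and the last letter fixes
          \<open>y\<close>.\<close>
        have "a \<bullet> w = 0"
          using eq eq2 IH(1) nn a by (smt (verit) mult_eq_0_iff)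
        then have "a \<bullet> y = 0" "hrefl_word es w \<bullet> u = w \<bullet> u"
          using y es simples_pos eq eq2 by auto
        then show ?thesis
          using IH(2) y by (simp add: as hrefl_orthogonal)
      qed
      then show ?thesis
        using eq IH(1) nn by auto
    qed
  qed
qed

text \<open>Move a generic point of the hyperplane of \<open>n\<close> into \<open>C\<close> by a word in the simple reflections;
  it then witnesses that the image of \<open>n\<close> is, up to sign, a simple root.\<close>

lemma hrefl_simple_word:
  assumes n: "n \<in> N"
  obtains as where "as \<in> lists simples" "hrefl n = hrefl_word as"
proof -
  have nn: "n \<bullet> n = 1"
    using norm_N n by (simp add: dot_square_norm)
  \<comment> \<open>Projections to the hyperplane of \<open>n\<close> of all roots other than
    \<open>n\<close> and \<open>- n\<close>. A root with zero projection is a multiple of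
    \<open>n\<close> of length 1, so none of them vanishes; projecting \<open>q\<close> gives a
    point \<open>p\<close> lying on this mirror only.\<close>
  define B where "B = (\<lambda>b. b - (b \<bullet> n) *\<^sub>R n) ` (roots - {n, - n})"
  have "finite B"
    using finite_roots by (simp add: B_def)
  moreover have "0 \<notin> B"
  proof
    assume "0 \<in> B"
    then obtain b where b: "b \<in> roots" "b \<noteq> n" "b \<noteq> - n" "b = (b \<bullet> n) *\<^sub>R n"
      unfolding B_def by fastforce
    then have "\<bar>b \<bullet> n\<bar> = 1"
      using roots_norm norm_N n by (metis mult.right_neutral norm_scaleR)
    then have "b \<bullet> n = 1 \<or> b \<bullet> n = - 1"
      by linarith
    then show False
      using b(2-) by (metis scaleR_one scaleR_minus1_left)
  qed
  ultimately obtain q where q: "\<And>b. b \<in> B \<Longrightarrow> b \<bullet> q \<noteq> 0"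
    using generic_point[of B UNIV] by auto
  define p where "p = q - (n \<bullet> q) *\<^sub>R n"
  have np: "n \<bullet> p = 0"
    by (simp add: p_def inner_diff_right nn)
  have bp: "b \<bullet> p \<noteq> 0" if "b \<in> roots" "b \<noteq> n" "b \<noteq> - n" for b
    using q[of "b - (b \<bullet> n) *\<^sub>R n"] that
    by (auto simp: p_def B_def inner_diff_left inner_diff_right)
  obtain as where as: "as \<in> lists simples" "hrefl_word as p \<in> C"
    using simple_word_into_C by blast
  let ?g = "hrefl_word as"
  have g: "?g \<in> G"
    using as simple_word_G by blast
  obtain h where h: "h \<in> G" "\<And>x. h (?g x) = x" "\<And>x. ?g (h x) = x"
    using G_inv g by blast
  have gn: "?g n \<in> roots"
    using g n G_roots N_subset_roots by blast
  \<comment> \<open>A root and its negative have the same reflection, so the positive one of the two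
    may stand for \<open>?g n\<close>.\<close>
  define a where "a = (if ?g n \<in> pos then ?g n else - ?g n)"
  have a: "a \<in> pos"
    using gn roots_cases by (auto simp: a_def)
  have "a \<bullet> ?g p = 0"
    using G_inner[OF g, of n p] np by (simp add: a_def)
  moreover have "0 < b \<bullet> ?g p" if b: "b \<in> pos" "b \<noteq> a" for b
  proof -
    have hb: "h b \<in> roots"
      using h b G_roots pos_roots by blast
    have "b \<noteq> ?g n"
      using b by (auto simp: a_def split: if_splits)
    moreover have "b \<noteq> - ?g n"
      using b a_def by (auto simp: pos_def split: if_splits)
    ultimately have "h b \<noteq> n" "h b \<noteq> - n"
      using h(3)[of b] linear_neg[OF G_linear[OF g]] by metis+
    then have "h b \<bullet> p \<noteq> 0"
      using bp hb by blast
    moreover have "b \<bullet> ?g p = h b \<bullet> p"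
      using G_inner[OF g, of "h b" p] h by simp
    ultimately show ?thesis
      using pos_C[OF b(1) as(2)] by simp
  qed
  ultimately have "a \<in> simples"
    using a as by (auto simp: simples_def)
  moreover have "hrefl (?g n) = hrefl a"
    using hrefl_scaleR[of "-1" "?g n"] by (simp add: a_def)
  moreover have "hrefl n x = hrefl_word (rev as) (hrefl (?g n) (?g x))" for x
    using orthogonal_transformation_conj_hrefl[OF G_orth[OF g]] hrefl_word_rev by metis
  ultimately have "hrefl n = hrefl_word (rev as @ [a] @ as)"
    by (auto simp: hrefl_word_append)
  then show thesis
    using that[of "rev as @ [a] @ as"] as(1) \<open>a \<in> simples\<close> by (simp add: lists_eq_set)
qed

section \<open>The chamber as a strict fundamental domain\<close>

lemma G_simple_word:
  assumes "g \<in> G"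
  obtains as where "as \<in> lists simples" "g = hrefl_word as"
proof -
  obtain ns where ns: "ns \<in> lists N" "g = hrefl_word ns"
    using assms by (auto simp: G_def)
  have "\<exists>as\<in>lists simples. hrefl_word ns = hrefl_word as"
    using ns(1)
  proof (induction ns)
    case Nil
    then show ?case by (intro bexI[of _ "[]"]) auto
  next
    case (Cons n ns)
    then obtain as where "as \<in> lists simples" "hrefl_word ns = hrefl_word as"
      by auto
    moreover obtain bs where "bs \<in> lists simples" "hrefl n = hrefl_word bs"
      using hrefl_simple_word Cons by auto
    ultimately show ?case
      by (intro bexI[of _ "bs @ as"]) (auto simp: hrefl_word_append)
  qed
  then show thesis
    using that ns by blast
qed

lemma G_inner_le:
  assumes "g \<in> G" "w \<in> C" "u \<in> reg" shows "g w \<bullet> u \<le> w \<bullet> u"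
  using G_simple_word simple_word_inner_le assms by metis

lemma G_inner_eq:
  assumes "g \<in> G" "w \<in> C" "u \<in> reg" "g w \<bullet> u = w \<bullet> u"
    "\<And>a. a \<in> pos \<Longrightarrow> a \<bullet> w = 0 \<Longrightarrow> a \<bullet> y = 0"
  shows "g y = y"
  using G_simple_word simple_word_inner_le assms by metis

lemma G_into_C:
  obtains g where "g \<in> G" "g y \<in> C"
proof -
  obtain as where "as \<in> lists simples" "hrefl_word as y \<in> C"
    by (rule simple_word_into_C)
  then show thesis
    by (intro that[of "hrefl_word as"] simple_word_G)
qed

text \<open>\<open>G_inner_le\<close> for \<open>g\<close> and for its inverse gives equality at
  \<open>c\<close>; then \<open>G_inner_eq\<close> applies to \<open>w\<close> itself.\<close>

lemma G_fundamental:
  assumes "g \<in> G" "w \<in> C" "g w \<in> C" shows "g w = w"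
proof -
  obtain h where h: "h \<in> G" "\<And>x. h (g x) = x" "\<And>x. g (h x) = x"
    using G_inv assms by blast
  have "g w \<bullet> c \<le> w \<bullet> c" "h (g w) \<bullet> c \<le> g w \<bullet> c"
    using G_inner_le[OF assms(1,2) c_reg] G_inner_le[OF h(1) assms(3) c_reg] .
  then have "g w \<bullet> c = w \<bullet> c"
    by (simp add: h(2))
  then show ?thesis
    by (rule G_inner_eq[OF assms(1,2) c_reg])
qed

end

subsection \<open>Polyhedral cones and normal cones of the symmetrized polytope\<close>

definition polar_cone :: "'a::euclidean_space set \<Rightarrow> 'a set" where
  "polar_cone A = {y. \<forall>a\<in>A. 0 \<le> a \<bullet> y}"

text \<open>The inequalities tight at \<open>w\<close> become equations. For finite \<open>A\<close>
  and \<open>w\<close> in the cone this is the smallest face containing \<open>w\<close>.\<close>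

definition tight_face :: "'a::euclidean_space set \<Rightarrow> 'a \<Rightarrow> 'a set" where
  "tight_face A w = {y \<in> polar_cone A. \<forall>a\<in>A. a \<bullet> w = 0 \<longrightarrow> a \<bullet> y = 0}"

lemma convex_polar_cone: "convex (polar_cone A)"
proof -
  have "polar_cone A = (\<Inter>a\<in>A. {y. a \<bullet> y \<ge> 0})"
    by (auto simp: polar_cone_def)
  then show ?thesis
    by (simp add: convex_INT convex_halfspace_ge)
qed

lemma convex_tight_face: "convex (tight_face A w)"
proof -
  have "tight_face A w = polar_cone A \<inter> (\<Inter>a\<in>{a \<in> A. a \<bullet> w = 0}. {y. a \<bullet> y = 0})"
    by (auto simp: tight_face_def)
  then show ?thesis
    by (simp only: convex_Int convex_INT convex_hyperplane convex_polar_cone)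
qed

lemma tight_face_self: "w \<in> polar_cone A \<Longrightarrow> w \<in> tight_face A w"
  by (simp add: tight_face_def)

lemma tight_face_face_of: "tight_face A w face_of polar_cone A"
  unfolding face_of_def
proof (intro conjI ballI impI)
  show "tight_face A w \<subseteq> polar_cone A"
    by (auto simp: tight_face_def)
  show "convex (tight_face A w)"
    by (rule convex_tight_face)
next
  fix y z x
  assume y: "y \<in> polar_cone A" and z: "z \<in> polar_cone A"
    and x: "x \<in> tight_face A w" and "x \<in> open_segment y z"
  then obtain u where u: "0 < u" "u < 1" "x = (1 - u) *\<^sub>R y + u *\<^sub>R z"
    by (auto simp: in_segment)
  have "a \<bullet> y = 0 \<and> a \<bullet> z = 0" if "a \<in> A" "a \<bullet> w = 0" for a
  proof -
    have "0 = (1 - u) * (a \<bullet> y) + u * (a \<bullet> z)"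
      using x that u by (auto simp: tight_face_def inner_add_right)
    moreover have "0 \<le> a \<bullet> y" "0 \<le> a \<bullet> z"
      using y z that by (auto simp: polar_cone_def)
    ultimately show ?thesis
      using u by (smt (verit) mult_pos_pos mult_nonneg_nonneg)
  qed
  then show "y \<in> tight_face A w" "z \<in> tight_face A w"
    using y z by (auto simp: tight_face_def)
qed

text \<open>Each strict inequality survives a small enough perturbation, and finitely many share a
  common bound.\<close>

lemma perturb_pos:
  fixes A :: "'a::euclidean_space set"
  assumes "finite A"
  obtains e :: real where "0 < e" "\<And>a. a \<in> A \<Longrightarrow> 0 < a \<bullet> w \<Longrightarrow> 0 < a \<bullet> (w + e *\<^sub>R z)"
proof -
  have ev: "eventually (\<lambda>e. 0 < a \<bullet> w \<longrightarrow> 0 < a \<bullet> (w + e *\<^sub>R z)) (at_right 0)" for a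
  proof (cases "0 < a \<bullet> w")
    case True
    have "((\<lambda>e. a \<bullet> (w + e *\<^sub>R z)) \<longlongrightarrow> a \<bullet> (w + 0 *\<^sub>R z)) (at_right 0)"
      by (intro tendsto_intros)
    then have "eventually (\<lambda>e. 0 < a \<bullet> (w + e *\<^sub>R z)) (at_right 0)"
      using True by (intro order_tendstoD) auto
    then show ?thesis
      by (rule eventually_mono) simp
  qed simp
  have "eventually (\<lambda>e. \<forall>a\<in>A. 0 < a \<bullet> w \<longrightarrow> 0 < a \<bullet> (w + e *\<^sub>R z)) (at_right (0::real))"
    using ev assms by (simp add: eventually_ball_finite)
  moreover have "eventually (\<lambda>e. 0 < e) (at_right (0::real))"
    by (simp add: eventually_at_right_less)
  ultimately have "eventually (\<lambda>e. 0 < e \<and> (\<forall>a\<in>A. 0 < a \<bullet> w \<longrightarrow> 0 < a \<bullet> (w + e *\<^sub>R z))) (at_right (0::real))"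
    by eventually_elim auto
  then show thesis
    using eventually_happens trivial_limit_at_right_real that by blast
qed

text \<open>The segment from \<open>y\<close> to \<open>w\<close> can be prolonged beyond
  \<open>w\<close> inside the cone: inequalities tight at \<open>w\<close> stay zero along it, the
  finitely many others have slack at \<open>w\<close>. So \<open>w\<close> is interior to a segment
  starting at \<open>y\<close>, and the face containing \<open>w\<close> contains
  \<open>y\<close>.\<close>

lemma tight_face_least:
  assumes "finite A" "F face_of polar_cone A" "w \<in> F"
  shows "tight_face A w \<subseteq> F"
proof
  fix y assume y: "y \<in> tight_face A w"
  have wA: "w \<in> polar_cone A"
    using assms face_of_imp_subset by blast
  show "y \<in> F"
  proof (cases "y = w")
    case True
    then show ?thesis using assms by simp
  next
    case False
    obtain e :: real where e0: "0 < e"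
        and e: "\<And>a. a \<in> A \<Longrightarrow> 0 < a \<bullet> w \<Longrightarrow> 0 < a \<bullet> (w + e *\<^sub>R (w - y))"
      using perturb_pos[OF assms(1)] by blast
    define z where "z = w + e *\<^sub>R (w - y)"
    have "0 \<le> a \<bullet> z" if a: "a \<in> A" for a
    proof (cases "a \<bullet> w = 0")
      case True
      then show ?thesis
        using y a by (simp add: z_def tight_face_def inner_add_right inner_diff_right)
    next
      case False
      then have "0 < a \<bullet> w"
        using wA a by (auto simp: polar_cone_def less_le)
      then show ?thesis
        using e[OF a] by (simp add: z_def)
    qed
    then have z: "z \<in> polar_cone A"
      by (simp add: polar_cone_def)
    \<comment> \<open>The weight of \<open>z\<close> when \<open>w\<close> is written as a convex
      combination of \<open>y\<close> and \<open>z\<close>.\<close>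
    define u where "u = 1 / (1 + e)"
    have u: "0 < u" "u < 1" "u * (1 + e) = 1"
      using e0 by (auto simp: u_def field_simps)
    have "(1 - u) *\<^sub>R y + u *\<^sub>R z = (u * (1 + e)) *\<^sub>R w + (1 - u * (1 + e)) *\<^sub>R y"
      by (simp add: z_def algebra_simps)
    also have "\<dots> = w"
      by (simp add: u)
    finally have "w = (1 - u) *\<^sub>R y + u *\<^sub>R z"
      by simp
    moreover have "y \<noteq> z"
    proof
      assume "y = z"
      then have "(1 + e) *\<^sub>R (w - y) = 0"
        by (simp add: z_def algebra_simps)
      then show False
        using e0 False by simp
    qed
    ultimately have "w \<in> open_segment y z"
      using u by (auto simp: in_segment)
    then show ?thesis
      using face_ofD[OF assms(2) _ _ z assms(3)] y by (simp add: tight_face_def)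
  qed
qed

text \<open>Any relative interior point \<open>w\<close> will do. A segment in \<open>F\<close> from
  \<open>y\<close> to \<open>w\<close> extends beyond \<open>w\<close>, and an inequality tight at
  \<open>w\<close> but nonnegative at both ends must vanish at \<open>y\<close>.\<close>

lemma face_eq_tight_face:
  assumes "finite A" "F face_of polar_cone A" "F \<noteq> {}"
  obtains w where "w \<in> F" "F = tight_face A w"
proof -
  have conv: "convex F"
    using assms face_of_imp_convex by blast
  then obtain w where w: "w \<in> rel_interior F"
    using assms rel_interior_eq_empty by blast
  then have wF: "w \<in> F"
    using rel_interior_subset by blast
  have sub: "F \<subseteq> polar_cone A"
    using assms face_of_imp_subset by blast
  have "F \<subseteq> tight_face A w"
  proof
    fix y assume y: "y \<in> F"
    then obtain e where e: "1 < e" "(1 - e) *\<^sub>R y + e *\<^sub>R w \<in> F"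
      using convex_rel_interior_if2[OF conv w] hull_inc by metis
    have "a \<bullet> y = 0" if "a \<in> A" "a \<bullet> w = 0" for a
    proof -
      have "0 \<le> a \<bullet> y" "0 \<le> (1 - e) * (a \<bullet> y)"
        using subsetD[OF sub y] subsetD[OF sub e(2)] that
        by (auto simp: polar_cone_def inner_add_right)
      then show ?thesis
        using e by (simp add: zero_le_mult_iff)
    qed
    then show "y \<in> tight_face A w"
      using y sub by (auto simp: tight_face_def)
  qed
  then show thesis
    using that wF tight_face_least[OF assms(1,2) wF] by blast
qed

section \<open>Faces of maximizers and normal cones\<close>

definition max_face :: "'a::euclidean_space set \<Rightarrow> 'a \<Rightarrow> 'a set" where
  "max_face P y = {u \<in> P. \<forall>u'\<in>P. y \<bullet> u' \<le> y \<bullet> u}"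

definition ncone :: "'a::euclidean_space set \<Rightarrow> 'a set \<Rightarrow> 'a set" where
  "ncone P F = {y. \<forall>u\<in>F. \<forall>u'\<in>P. y \<bullet> u' \<le> y \<bullet> u}"

text \<open>Membership in a normal cone becomes an inclusion of faces of maximizers, the form in
  which normal cones are compared later.\<close>

lemma ncone_iff: "F \<subseteq> P \<Longrightarrow> y \<in> ncone P F \<longleftrightarrow> F \<subseteq> max_face P y"
  by (auto simp: ncone_def max_face_def)

lemma max_face_subset: "max_face P y \<subseteq> P"
  by (auto simp: max_face_def)

lemma max_face_eq: "p \<in> max_face P y \<Longrightarrow> q \<in> max_face P y \<Longrightarrow> y \<bullet> p = y \<bullet> q"
  by (rule order_antisym) (auto simp: max_face_def)

lemma max_face_hyperplane:
  assumes p: "p \<in> max_face P y" shows "max_face P y = P \<inter> {u. y \<bullet> u = y \<bullet> p}"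
proof (intro equalityI subsetI)
  fix u assume "u \<in> max_face P y"
  then show "u \<in> P \<inter> {u. y \<bullet> u = y \<bullet> p}"
    using max_face_eq[OF _ p] max_face_subset by blast
next
  fix u assume "u \<in> P \<inter> {u. y \<bullet> u = y \<bullet> p}"
  then show "u \<in> max_face P y"
    using p by (simp add: max_face_def)
qed

lemma max_face_face_of:
  assumes "convex P" shows "max_face P y face_of P"
proof (cases "max_face P y = {}")
  case False
  then obtain p where p: "p \<in> max_face P y"
    by blast
  then have "\<And>u. u \<in> P \<Longrightarrow> y \<bullet> u \<le> y \<bullet> p"
    by (auto simp: max_face_def)
  then show ?thesis
    using face_of_Int_supporting_hyperplane_le[OF assms] max_face_hyperplane[OF p] by metis
qed (simp add: empty_face_of)

lemma max_face_nonempty: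
  assumes "compact P" "P \<noteq> {}" shows "max_face P y \<noteq> {}"
proof -
  have "continuous_on P (\<lambda>u. y \<bullet> u)"
    by (intro continuous_intros)
  then show ?thesis
    using continuous_attains_sup[OF assms] by (auto simp: max_face_def)
qed

lemma face_eq_max_face:
  assumes "polytope P" "F face_of P" "F \<noteq> {}"
  obtains y where "F = max_face P y"
proof -
  have "F exposed_face_of P"
    using assms exposed_face_of_polyhedron polytope_imp_polyhedron by blast
  then obtain a b where ab: "P \<subseteq> {x. a \<bullet> x \<le> b}" "F = P \<inter> {x. a \<bullet> x = b}"
    by (auto simp: exposed_face_of_def)
  obtain f where "f \<in> F"
    using assms by blast
  then have "F = max_face P a"
    using ab by (auto simp: max_face_def order_antisym)
  then show thesis
    using that by blast
qed

text \<open>Faces of polytopes are exposed, so some \<open>y\<close> is maximal exactly on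
  \<open>F2\<close>. It lies in \<open>ncone P F2\<close>, and for it to lie in
  \<open>ncone P F1\<close> means \<open>F1 \<subseteq> F2\<close>.\<close>

lemma ncone_subset_iff:
  assumes "polytope P" "F1 face_of P" "F1 \<noteq> {}" "F2 face_of P" "F2 \<noteq> {}"
  shows "ncone P F2 \<subseteq> ncone P F1 \<longleftrightarrow> F1 \<subseteq> F2"
proof
  assume *: "ncone P F2 \<subseteq> ncone P F1"
  obtain y where y: "F2 = max_face P y"
    using face_eq_max_face assms by blast
  then have "y \<in> ncone P F2"
    by (auto simp: ncone_def max_face_def)
  then show "F1 \<subseteq> F2"
    using * y ncone_iff[of F1 P y] assms face_of_imp_subset by blast
qed (auto simp: ncone_def)

text \<open>By convexity it is enough to compare generators. With finite generating sets the normal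
  cone is cut out by finitely many inequalities, as the lemmas on tight faces require.\<close>

lemma ncone_convex_hull:
  "ncone (convex hull E) (convex hull E') = polar_cone {f - v | f v. f \<in> E' \<and> v \<in> E}"
proof (intro equalityI subsetI)
  fix y assume "y \<in> ncone (convex hull E) (convex hull E')"
  then show "y \<in> polar_cone {f - v | f v. f \<in> E' \<and> v \<in> E}"
    using hull_inc[of _ E convex] hull_inc[of _ E' convex]
    by (auto simp: ncone_def polar_cone_def inner_diff_right inner_commute[of _ y])
next
  fix y assume y: "y \<in> polar_cone {f - v | f v. f \<in> E' \<and> v \<in> E}"
  have le: "y \<bullet> v \<le> y \<bullet> f" if "f \<in> E'" "v \<in> E" for f v
  proof -
    have "0 \<le> (f - v) \<bullet> y"
      using y that unfolding polar_cone_def by blast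
    then show ?thesis
      by (simp add: inner_commute[of "f - v"] inner_diff_right)
  qed
  have "E \<subseteq> {x. y \<bullet> x \<le> y \<bullet> f}" if "f \<in> E'" for f
    using le that by auto
  then have 1: "convex hull E \<subseteq> {x. y \<bullet> x \<le> y \<bullet> f}" if "f \<in> E'" for f
    using that by (simp add: hull_minimal convex_halfspace_le)
  have "E' \<subseteq> {x. y \<bullet> x \<ge> y \<bullet> u}" if "u \<in> convex hull E" for u
    using 1 that by auto
  then have "convex hull E' \<subseteq> {x. y \<bullet> x \<ge> y \<bullet> u}" if "u \<in> convex hull E" for u
    using that by (simp add: hull_minimal convex_halfspace_ge)
  then show "y \<in> ncone (convex hull E) (convex hull E')"
    by (auto simp: ncone_def)
qed

context finite_reflections
begin

section \<open>Cones of the refined fundamental fan\<close>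

lemma C_polar: "C = polar_cone pos"
  by (auto simp: polar_cone_def C_iff_pos)

text \<open>The preimage of the unique cone of the refined fundamental fan that has \<open>w\<close> in its relative
  interior.\<close>

definition refined_cone :: "'a set \<Rightarrow> 'a \<Rightarrow> 'a set" where
  "refined_cone P w = {y \<in> C. max_face P w \<subseteq> max_face P y \<and> (\<forall>a\<in>pos. a \<bullet> w = 0 \<longrightarrow> a \<bullet> y = 0)}"

text \<open>Used for the polytope translated by \<open>- x0\<close>. The group acts from the left
  here; the right action is by inverses, which run through the same group
  (\<open>symmetrization_eq\<close>).\<close>

definition sym_hull :: "'a set \<Rightarrow> 'a set" where
  "sym_hull P = convex hull {g x | g x. g \<in> G \<and> x \<in> P}"

lemma refined_cone_self: "w \<in> C \<Longrightarrow> w \<in> refined_cone P w"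
  by (simp add: refined_cone_def)

lemma refined_cone_subset_C: "refined_cone P w \<subseteq> C"
  by (auto simp: refined_cone_def)

lemma refined_cone_subset_tight_face: "refined_cone P w \<subseteq> tight_face pos w"
  by (auto simp: refined_cone_def tight_face_def C_polar)

text \<open>For \<open>f\<close> maximizing \<open>w\<close>, the inequality \<open>f - v\<close> is
  tight at \<open>w\<close> exactly if \<open>v\<close> maximizes \<open>w\<close> too. Hence the
  tight equations say that all maximizers of \<open>w\<close> maximize \<open>y\<close>, whichever
  \<open>F\<close> was used to describe the normal cone.\<close>

lemma refined_cone_eq_tight_face:
  assumes E: "P = convex hull E" "finite E" and E': "F = convex hull E'" "E' \<noteq> {}"
    and F: "F \<subseteq> max_face P w"
  shows "refined_cone P w = tight_face ({f - v | f v. f \<in> E' \<and> v \<in> E} \<union> pos) w"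
    (is "_ = tight_face (?A \<union> pos) w")
proof (intro equalityI subsetI)
  have Pc: "polar_cone (?A \<union> pos) = ncone P F \<inter> C"
    unfolding E E' ncone_convex_hull C_polar by (auto simp: polar_cone_def)
  have FP: "F \<subseteq> P"
    using F max_face_subset by blast
  fix y
  {
    assume y: "y \<in> refined_cone P w"
    then have sub: "max_face P w \<subseteq> max_face P y"
      by (simp add: refined_cone_def)
    then have "y \<in> ncone P F \<inter> C"
      using y F FP by (auto simp: ncone_iff refined_cone_def)
    moreover have "a \<bullet> y = 0" if a: "a \<in> ?A" "a \<bullet> w = 0" for a
    proof -
      obtain f v where fv: "f \<in> E'" "v \<in> E" "a = f - v"
        using a by blast
      then have f: "f \<in> max_face P w"
        using F E' hull_inc by fastforce
      moreover have "w \<bullet> v = w \<bullet> f"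
        using a(2) by (simp add: fv(3) inner_commute[of "f - v"] inner_diff_right)
      moreover have "v \<in> P"
        using fv(2) E(1) by (simp add: hull_inc)
      ultimately have "v \<in> max_face P w"
        by (simp add: max_face_hyperplane)
      then have "y \<bullet> v = y \<bullet> f"
        using f sub max_face_eq by blast
      then show ?thesis
        by (simp add: fv(3) inner_commute[of "f - v"] inner_diff_right)
    qed
    moreover have "\<forall>a\<in>pos. a \<bullet> w = 0 \<longrightarrow> a \<bullet> y = 0"
      using y by (simp add: refined_cone_def)
    ultimately show "y \<in> tight_face (?A \<union> pos) w"
      unfolding tight_face_def Pc by blast
  next
    assume y: "y \<in> tight_face (?A \<union> pos) w"
    then have yC: "y \<in> ncone P F \<inter> C" and tight: "\<And>a. a \<in> ?A \<union> pos \<Longrightarrow> a \<bullet> w = 0 \<Longrightarrow> a \<bullet> y = 0"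
      unfolding tight_face_def Pc by blast+
    obtain f where f: "f \<in> E'"
      using E' by blast
    then have fw: "f \<in> max_face P w" and fy: "f \<in> max_face P y"
      using F E' yC FP hull_inc[of f E'] by (auto simp: ncone_iff)
    have "convex P"
      by (simp add: E)
    then have face: "max_face P w face_of convex hull E" and conv: "convex (max_face P y)"
      using max_face_face_of face_of_imp_convex E by metis+
    \<comment> \<open>The face is spanned by generators of \<open>P\<close>; each of them gives a
      tight inequality \<open>f - s\<close>, and convexity of \<open>max_face P y\<close> extends
      the conclusion to the whole face.\<close>
    obtain S where S: "S \<subseteq> E" "max_face P w = convex hull S"
      using face_of_convex_hull_subset[OF _ face] E finite_imp_compact by blast
    have "s \<in> max_face P y" if s: "s \<in> S" for s
    proof -
      have sw: "s \<in> max_face P w"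
        using S s hull_inc by fastforce
      have "f - s \<in> ?A"
        using f s S by blast
      moreover have "(f - s) \<bullet> w = 0"
        using max_face_eq[OF fw sw] by (simp add: inner_commute[of "f - s"] inner_diff_right)
      ultimately have "y \<bullet> s = y \<bullet> f"
        using tight[of "f - s"] by (simp add: inner_commute[of "f - s"] inner_diff_right)
      then show ?thesis
        using sw max_face_subset by (auto simp: max_face_hyperplane[OF fy])
    qed
    then have "max_face P w \<subseteq> max_face P y"
      unfolding S using conv by (intro hull_minimal) auto
    then show "y \<in> refined_cone P w"
      using yC tight by (auto simp: refined_cone_def)
  }
qed

lemma ncone_Int_C:
  assumes "polytope P" "F face_of P" "F \<noteq> {}"
  obtains A where "finite A" "ncone P F \<inter> C = polar_cone A"
    "\<And>w. F \<subseteq> max_face P w \<Longrightarrow> refined_cone P w = tight_face A w"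
proof -
  obtain E where E: "finite E" "P = convex hull E"
    using assms polytope_def by blast
  obtain E' where E': "E' \<subseteq> E" "F = convex hull E'"
    using face_of_convex_hull_subset E assms finite_imp_compact by metis
  have "E' \<noteq> {}"
    using E' assms by auto
  let ?A = "{f - v | f v. f \<in> E' \<and> v \<in> E}"
  have "?A = (\<lambda>(f, v). f - v) ` (E' \<times> E)"
    by auto
  then have "finite ?A"
    using E E' finite_subset by (metis finite_SigmaI finite_imageI)
  then show thesis
  proof (intro that[of "?A \<union> pos"])
    show "ncone P F \<inter> C = polar_cone (?A \<union> pos)"
      unfolding E E' ncone_convex_hull C_polar by (auto simp: polar_cone_def)
    show "refined_cone P w = tight_face (?A \<union> pos) w" if "F \<subseteq> max_face P w" for w
      using refined_cone_eq_tight_face[OF E(2,1) E'(2) \<open>E' \<noteq> {}\<close> that] .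
  qed (simp add: finite_pos)
qed

text \<open>A face is the tight face of one of its points, and at a point of the normal cone of
  \<open>F\<close> tight faces are refined cones. \<open>refined_cone_face_of\<close> is the
  converse, with \<open>F\<close> the face of maximizers of \<open>w\<close>.\<close>

lemma face_refined_cone:
  assumes "polytope P" "F face_of P" "F \<noteq> {}" "T face_of ncone P F \<inter> C" "T \<noteq> {}"
  obtains w where "w \<in> C" "T = refined_cone P w"
proof -
  obtain A where A: "finite A" "ncone P F \<inter> C = polar_cone A"
    "\<And>w. F \<subseteq> max_face P w \<Longrightarrow> refined_cone P w = tight_face A w"
    using ncone_Int_C[OF assms(1-3)] by metis
  obtain w where w: "w \<in> T" "T = tight_face A w"
    using face_eq_tight_face[OF A(1)] A(2) assms by metis
  then have "w \<in> ncone P F \<inter> C"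
    using assms face_of_imp_subset by blast
  then have "F \<subseteq> max_face P w" "w \<in> C"
    using assms(2) face_of_imp_subset ncone_iff by blast+
  then show thesis
    using that A w by blast
qed

lemma refined_cone_face_of:
  assumes "polytope P" "P \<noteq> {}"
  shows "refined_cone P w face_of ncone P (max_face P w) \<inter> C"
proof -
  have "max_face P w face_of P" "max_face P w \<noteq> {}"
    using assms max_face_face_of max_face_nonempty polytope_imp_convex polytope_imp_compact by blast+
  then obtain A where "ncone P (max_face P w) \<inter> C = polar_cone A"
    "\<And>v. max_face P w \<subseteq> max_face P v \<Longrightarrow> refined_cone P v = tight_face A v"
    using ncone_Int_C[OF assms(1)] by metis
  then show ?thesis
    using tight_face_face_of by simp
qed

section \<open>The symmetrized polytope and its normal cones\<close>

lemma sym_hull_convex_hull: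
  assumes "P = convex hull E"
  shows "sym_hull P = convex hull {g x | g x. g \<in> G \<and> x \<in> E}" (is "_ = convex hull ?S")
proof
  have "E \<subseteq> P"
    by (simp add: assms hull_subset)
  then show "convex hull ?S \<subseteq> sym_hull P"
    unfolding sym_hull_def by (intro hull_mono) blast
  have "g x \<in> convex hull ?S" if "g \<in> G" "x \<in> P" for g x
  proof -
    have "g x \<in> convex hull (g ` E)"
      using that convex_hull_linear_image[OF G_linear, of g E] assms by auto
    also have "\<dots> \<subseteq> convex hull ?S"
      using that by (intro hull_mono) blast
    finally show ?thesis .
  qed
  then show "sym_hull P \<subseteq> convex hull ?S"
    unfolding sym_hull_def by (intro hull_minimal) auto
qed

lemma finite_G_image: "finite E \<Longrightarrow> finite {g x | g x. g \<in> G \<and> x \<in> E}"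
  using finite_G by (simp add: finite_image_set2)

lemma polytope_sym_hull:
  assumes "polytope P" shows "polytope (sym_hull P)"
proof -
  obtain E where "finite E" "P = convex hull E"
    using assms polytope_def by blast
  then show ?thesis
    by (simp add: sym_hull_convex_hull finite_G_image polytope_convex_hull)
qed

lemma subset_sym_hull: "P \<subseteq> sym_hull P"
proof
  fix x assume "x \<in> P"
  then have "id x \<in> {g x | g x. g \<in> G \<and> x \<in> P}"
    using G_id by blast
  then show "x \<in> sym_hull P"
    unfolding sym_hull_def by (simp add: hull_inc)
qed

lemma G_sym_hull:
  assumes "g \<in> G" "q \<in> sym_hull P" shows "g q \<in> sym_hull P"
proof -
  let ?S = "{g x | g x. g \<in> G \<and> x \<in> P}"
  have "g ` ?S \<subseteq> ?S"
  proof safe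
    fix h x assume "h \<in> G" "x \<in> P"
    then show "\<exists>g' x'. g (h x) = g' x' \<and> g' \<in> G \<and> x' \<in> P"
      using G_comp[OF assms(1), of h] by (intro exI[of _ "g \<circ> h"] exI[of _ x]) simp
  qed
  then have "convex hull (g ` ?S) \<subseteq> sym_hull P"
    unfolding sym_hull_def by (rule hull_mono)
  then show ?thesis
    using assms convex_hull_linear_image[OF G_linear[OF assms(1)], of ?S]
    by (auto simp: sym_hull_def)
qed

text \<open>Moving \<open>g\<close> to the other side of the inner product as its inverse
  \<open>h\<close> gives \<open>h w \<bullet> x\<close>, and \<open>G_inner_le\<close> applies
  because points of \<open>P\<close> are interior to \<open>C\<close>.\<close>

lemma sym_hull_le:
  assumes "P \<subseteq> reg" "w \<in> C" "p \<in> max_face P w" "q \<in> sym_hull P"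
  shows "w \<bullet> q \<le> w \<bullet> p"
proof -
  have "w \<bullet> g x \<le> w \<bullet> p" if gx: "g \<in> G" "x \<in> P" for g x
  proof -
    obtain h where h: "h \<in> G" "\<And>x. h (g x) = x" "\<And>x. g (h x) = x"
      using G_inv gx by metis
    have "w \<bullet> g x = h w \<bullet> x"
      using G_inner[OF h(1), of w "g x"] h(2) by simp
    also have "\<dots> \<le> w \<bullet> x"
      using G_inner_le h(1) assms gx by blast
    also have "\<dots> \<le> w \<bullet> p"
      using assms gx by (simp add: max_face_def)
    finally show ?thesis .
  qed
  then have "sym_hull P \<subseteq> {q. w \<bullet> q \<le> w \<bullet> p}"
    unfolding sym_hull_def by (intro hull_minimal) (auto simp: convex_halfspace_le)
  then show ?thesis
    using assms by blast
qed

lemma max_face_subset_sym_hull: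
  assumes "P \<subseteq> reg" "w \<in> C"
  shows "max_face P w \<subseteq> max_face (sym_hull P) w"
  using sym_hull_le[OF assms] subset_sym_hull[of P] by (auto simp: max_face_def)

text \<open>Points of \<open>P\<close> are interior to \<open>C\<close>, so equality in
  \<open>G_inner_le\<close> at such a point is rigid: by \<open>G_inner_eq\<close> the group element
  fixes the vector. Both inclusions produce such an equality.\<close>

lemma ncone_sym_hull:
  assumes P: "polytope P" "P \<noteq> {}" "P \<subseteq> reg" and w: "w \<in> C"
  shows "ncone (sym_hull P) (max_face (sym_hull P) w) = refined_cone P w"
proof (intro equalityI subsetI)
  let ?Q = "sym_hull P"
  have ne: "max_face P v \<noteq> {}" for v
    using P max_face_nonempty polytope_imp_compact by blast
  have nc: "y \<in> ncone ?Q (max_face ?Q w) \<longleftrightarrow> max_face ?Q w \<subseteq> max_face ?Q y" for y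
    by (rule ncone_iff) (rule max_face_subset)
  obtain p where p: "p \<in> max_face P w"
    using ne by blast
  then have pP: "p \<in> P" "p \<in> reg" and pQ: "p \<in> max_face ?Q w"
    using max_face_subset max_face_subset_sym_hull P w by blast+
  fix y
  {
    assume "y \<in> ncone ?Q (max_face ?Q w)"
    then have y: "max_face ?Q w \<subseteq> max_face ?Q y"
      by (simp add: nc)
    then have py: "p \<in> max_face ?Q y"
      using pQ by blast
    \<comment> \<open>Moving \<open>y\<close> into \<open>C\<close> cannot lower its product with
      \<open>p\<close>. It cannot raise it either, since \<open>p\<close> already maximizes
      \<open>y\<close> on an invariant polytope. Equality makes the inverse \<open>h\<close> fix
      \<open>g y\<close>, so \<open>y\<close> was in \<open>C\<close> from the start.\<close>
    obtain g where g: "g \<in> G" "g y \<in> C"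
      by (rule G_into_C)
    obtain h where h: "h \<in> G" "\<And>x. h (g x) = x" "\<And>x. g (h x) = x"
      using G_inv g(1) by metis
    obtain p' where p': "p' \<in> max_face P (g y)"
      using ne by blast
    have "p' \<in> ?Q"
      using p' max_face_subset subset_sym_hull by blast
    then have "h p' \<in> ?Q"
      using G_sym_hull h(1) by blast
    have "g y \<bullet> p \<le> g y \<bullet> p'"
      using p' pP by (simp add: max_face_def)
    also have "\<dots> = y \<bullet> h p'"
      using G_inner[OF h(1), of "g y" p'] h(2) by simp
    also have "\<dots> \<le> y \<bullet> p"
      using py \<open>h p' \<in> ?Q\<close> by (simp add: max_face_def)
    finally have 1: "g y \<bullet> p \<le> h (g y) \<bullet> p"
      by (simp add: h)
    moreover have "h (g y) \<bullet> p \<le> g y \<bullet> p"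
      using G_inner_le h(1) g pP by blast
    ultimately have "h (g y) \<bullet> p = g y \<bullet> p"
      by simp
    then have "h (g y) = g y"
      by (rule G_inner_eq[OF h(1) g(2) pP(2)])
    then have yC: "y \<in> C"
      using g h by simp
    have "max_face P w \<subseteq> max_face ?Q y"
      using y max_face_subset_sym_hull[OF P(3) w] by blast
    then have "max_face P w \<subseteq> max_face P y"
      using subset_sym_hull[of P] max_face_subset[of P w] by (auto simp: max_face_def)
    \<comment> \<open>The mirror image of \<open>p\<close> also maximizes \<open>w\<close>, hence
      \<open>y\<close>. The two points differ by a nonzero multiple of \<open>a\<close>, because
      \<open>p\<close> lies off the mirror.\<close>
    moreover have "a \<bullet> y = 0" if a: "a \<in> pos" "a \<bullet> w = 0" for a
    proof -
      have aG: "hrefl a \<in> G"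
        using a roots_hrefl pos_roots by blast
      have "w \<bullet> hrefl a p = w \<bullet> p"
        using hrefl_inner[of a w p] hrefl_orthogonal[OF a(2)] by simp
      moreover have "hrefl a p \<in> ?Q"
        using aG G_sym_hull pQ max_face_subset by blast
      ultimately have "hrefl a p \<in> max_face ?Q w"
        by (simp add: max_face_hyperplane[OF pQ])
      then have "y \<bullet> hrefl a p = y \<bullet> p"
        using y py max_face_eq by blast
      then have "(2 * (p \<bullet> a) / (a \<bullet> a)) * (y \<bullet> a) = 0"
        by (simp add: hrefl_def inner_diff_right)
      moreover have "0 < p \<bullet> a"
        using pos_reg a pP by (metis inner_commute)
      moreover have "a \<bullet> a \<noteq> 0"
        using \<open>0 < p \<bullet> a\<close> by auto
      ultimately show ?thesis
        by (simp add: inner_commute)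
    qed
    ultimately show "y \<in> refined_cone P w"
      using yC by (simp add: refined_cone_def)
  next
    assume y: "y \<in> refined_cone P w"
    then have yC: "y \<in> C" and py: "p \<in> max_face P y"
      using p by (auto simp: refined_cone_def)
    have pQy: "p \<in> max_face ?Q y"
      using py max_face_subset_sym_hull[OF P(3) yC] by blast
    obtain E where E: "finite E" "P = convex hull E"
      using P polytope_def by blast
    let ?S = "{g x | g x. g \<in> G \<and> x \<in> E}"
    have face: "max_face ?Q w face_of convex hull ?S"
      using max_face_face_of[of ?Q w] sym_hull_convex_hull[OF E(2)] by simp
    obtain S where S: "S \<subseteq> ?S" "max_face ?Q w = convex hull S"
      using face_of_convex_hull_subset[OF _ face] finite_imp_compact finite_G_image[OF E(1)] by blast
    have "s \<in> max_face ?Q y" if s: "s \<in> S" for s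
    proof -
      have sw: "s \<in> max_face ?Q w"
        using S s hull_inc by fastforce
      obtain g x where "g \<in> G" "x \<in> E" "s = g x"
        using S s by blast
      then have gx: "g \<in> G" "x \<in> P" "s = g x"
        by (simp_all add: E(2) hull_inc)
      obtain h where h: "h \<in> G" "\<And>x. h (g x) = x" "\<And>x. g (h x) = x"
        using G_inv gx(1) by metis
      \<comment> \<open>The chain \<open>w \<bullet> p = h w \<bullet> x \<le> w \<bullet> x \<le> w
        \<bullet> p\<close> collapses: \<open>x\<close> maximizes \<open>w\<close> on
        \<open>P\<close>, and \<open>h\<close> fixes every vector on which all roots tight at
        \<open>w\<close> vanish, \<open>y\<close> among them.\<close>
      have "h w \<bullet> x = w \<bullet> s"
        using G_inner[OF h(1), of w s] h(2) gx by simp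
      also have "\<dots> = w \<bullet> p"
        using max_face_eq[OF sw pQ] .
      finally have hp: "h w \<bullet> x = w \<bullet> p" .
      moreover have "h w \<bullet> x \<le> w \<bullet> x"
        using G_inner_le h(1) w gx P by blast
      moreover have "w \<bullet> x \<le> w \<bullet> p"
        using p gx by (simp add: max_face_def)
      ultimately have wx: "w \<bullet> x = w \<bullet> p" and "h w \<bullet> x = w \<bullet> x"
        by auto
      then have hy: "h y = y"
        using y gx P by (intro G_inner_eq[OF h(1) w, of x]) (auto simp: refined_cone_def)
      have "x \<in> max_face P w"
        using wx gx by (simp add: max_face_hyperplane[OF p])
      then have "x \<in> max_face P y"
        using y by (auto simp: refined_cone_def)
      then have "y \<bullet> x = y \<bullet> p"
        using py by (rule max_face_eq)
      moreover have "y \<bullet> s = y \<bullet> x"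
        using G_inner[OF h(1), of y s] h(2) gx hy by simp
      moreover have "s \<in> ?Q"
        using sw max_face_subset by blast
      ultimately show ?thesis
        by (simp add: max_face_hyperplane[OF pQy])
    qed
    moreover have "convex (max_face ?Q y)"
    proof (rule face_of_imp_convex)
      show "max_face ?Q y face_of ?Q"
        by (rule max_face_face_of) (simp add: sym_hull_def)
    qed
    ultimately have "max_face ?Q w \<subseteq> max_face ?Q y"
      unfolding S by (intro hull_minimal) auto
    then show "y \<in> ncone ?Q (max_face ?Q w)"
      by (simp add: nc)
  }
qed

lemma max_face_sym_hull_G:
  assumes "g \<in> G"
  shows "g q \<in> max_face (sym_hull P) (g y) \<longleftrightarrow> q \<in> max_face (sym_hull P) y"
proof -
  obtain h where h: "h \<in> G" "\<And>x. h (g x) = x" "\<And>x. g (h x) = x"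
    using G_inv assms by metis
  have mem: "g u \<in> sym_hull P \<longleftrightarrow> u \<in> sym_hull P" for u
    using G_sym_hull[OF assms, of u] G_sym_hull[OF h(1), of "g u"] h(2) by auto
  have "(\<forall>u\<in>sym_hull P. g y \<bullet> u \<le> g y \<bullet> g q) \<longleftrightarrow> (\<forall>u\<in>sym_hull P. g y \<bullet> g u \<le> g y \<bullet> g q)"
    using mem h by metis
  then show ?thesis
    by (simp add: max_face_def mem G_inner[OF assms])
qed

lemma ncone_sym_hull_G:
  assumes "g \<in> G"
  shows "ncone (sym_hull P) (max_face (sym_hull P) (g w)) =
    g ` ncone (sym_hull P) (max_face (sym_hull P) w)"
proof -
  obtain h where h: "h \<in> G" "\<And>x. h (g x) = x" "\<And>x. g (h x) = x"
    using G_inv assms by metis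
  have "g y \<in> ncone (sym_hull P) (max_face (sym_hull P) (g w)) \<longleftrightarrow>
    y \<in> ncone (sym_hull P) (max_face (sym_hull P) w)" for y
    unfolding ncone_iff[OF max_face_subset] subset_iff
    using max_face_sym_hull_G[OF assms] h by metis
  then show ?thesis
    using h by (auto simp: image_iff) metis
qed

lemma normal_cones_sym_hull:
  assumes "polytope P" "P \<noteq> {}" "P \<subseteq> reg"
  shows "ncone (sym_hull P) ` {F. F face_of sym_hull P \<and> F \<noteq> {}} =
    {g ` refined_cone P w | g w. g \<in> G \<and> w \<in> C}"
proof (intro equalityI subsetI)
  let ?Q = "sym_hull P"
  fix N assume "N \<in> ncone ?Q ` {F. F face_of ?Q \<and> F \<noteq> {}}"
  then obtain F where F: "F face_of ?Q" "F \<noteq> {}" "N = ncone ?Q F"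
    by blast
  obtain y where y: "F = max_face ?Q y"
    using face_eq_max_face[OF polytope_sym_hull[OF assms(1)] F(1,2)] .
  obtain g where g: "g \<in> G" "g y \<in> C"
    by (rule G_into_C)
  obtain h where h: "h \<in> G" "\<And>x. h (g x) = x" "\<And>x. g (h x) = x"
    using G_inv g(1) by metis
  have "N = h ` refined_cone P (g y)"
    using ncone_sym_hull_G[OF h(1), of P "g y"] ncone_sym_hull[OF assms g(2)] F y h by simp
  then show "N \<in> {g ` refined_cone P w | g w. g \<in> G \<and> w \<in> C}"
    using h g by blast
next
  let ?Q = "sym_hull P"
  fix N assume "N \<in> {g ` refined_cone P w | g w. g \<in> G \<and> w \<in> C}"
  then obtain g w where gw: "g \<in> G" "w \<in> C" "N = g ` refined_cone P w"
    by blast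
  then have "N = ncone ?Q (max_face ?Q (g w))"
    by (simp add: ncone_sym_hull_G ncone_sym_hull[OF assms])
  moreover have "max_face ?Q (g w) face_of ?Q" "max_face ?Q (g w) \<noteq> {}"
  proof -
    have Q: "polytope ?Q" "?Q \<noteq> {}"
      using polytope_sym_hull[OF assms(1)] subset_sym_hull[of P] assms(2) by auto
    show "max_face ?Q (g w) face_of ?Q"
      using Q by (intro max_face_face_of polytope_imp_convex)
    show "max_face ?Q (g w) \<noteq> {}"
      using Q by (intro max_face_nonempty polytope_imp_compact)
  qed
  ultimately show "N \<in> ncone ?Q ` {F. F face_of ?Q \<and> F \<noteq> {}}"
    by blast
qed

end

subsection \<open>Passage to the quotient space\<close>

text \<open>Both posets are images of one index set, neither parametrization being injective.
  Equivalence of the orders together with antisymmetry forces the two parametrizations to identify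
  the same indices, so the correspondence descends to a bijection.\<close>

lemma poset_isomorphic_paramI:
  assumes "A = a ` I" "B = b ` I"
    and iff: "\<And>i j. i \<in> I \<Longrightarrow> j \<in> I \<Longrightarrow> le_A (a i) (a j) \<longleftrightarrow> le_B (b i) (b j)"
    and antisym_A: "\<And>i j. i \<in> I \<Longrightarrow> j \<in> I \<Longrightarrow> le_A (a i) (a j) \<Longrightarrow> le_A (a j) (a i) \<Longrightarrow> a i = a j"
    and antisym_B: "\<And>i j. i \<in> I \<Longrightarrow> j \<in> I \<Longrightarrow> le_B (b i) (b j) \<Longrightarrow> le_B (b j) (b i) \<Longrightarrow> b i = b j"
    and refl_B: "\<And>i. i \<in> I \<Longrightarrow> le_B (b i) (b i)"
  shows "poset_isomorphic A le_A B le_B"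
proof -
  have eq: "a i = a j \<longleftrightarrow> b i = b j" if ij: "i \<in> I" "j \<in> I" for i j
  proof
    assume "a i = a j"
    then have "le_B (b i) (b j)" "le_B (b j) (b i)"
      using iff[of i j] iff[of j i] iff[of i i] refl_B[of i] ij by auto
    then show "b i = b j"
      using antisym_B ij by blast
  next
    assume "b i = b j"
    then have "le_A (a i) (a j)" "le_A (a j) (a i)"
      using iff[of i j] iff[of j i] refl_B[of j] ij by auto
    then show "a i = a j"
      using antisym_A ij by blast
  qed
  define f where "f = b \<circ> inv_into I a"
  have f: "f (a i) = b i" if "i \<in> I" for i
  proof -
    have "inv_into I a (a i) \<in> I" "a (inv_into I a (a i)) = a i"
      using that by (auto intro: inv_into_into f_inv_into_f)
    then show ?thesis
      using eq[of "inv_into I a (a i)" i] that by (simp add: f_def)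
  qed
  have "inj_on f A"
    unfolding assms(1) by (rule inj_onI) (auto simp: f eq)
  moreover have "f ` A = B"
    unfolding assms(1,2) by (auto simp: f image_iff)
  ultimately show ?thesis
    unfolding poset_isomorphic_def using iff assms(1)
    by (intro exI[of _ f]) (auto simp: bij_betw_def f)
qed

lemma poset_isomorphic_dual:
  "poset_isomorphic A le_A B le_B \<Longrightarrow>
    poset_isomorphic A (\<lambda>x y. le_A y x) B (\<lambda>x y. le_B y x)"
  unfolding poset_isomorphic_def by blast

lemma poset_isomorphic_sym:
  assumes "poset_isomorphic A le_A B le_B" shows "poset_isomorphic B le_B A le_A"
proof -
  obtain f where f: "bij_betw f A B" "\<And>x y. x \<in> A \<Longrightarrow> y \<in> A \<Longrightarrow> le_A x y \<longleftrightarrow> le_B (f x) (f y)"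
    using assms by (auto simp: poset_isomorphic_def)
  let ?g = "inv_into A f"
  have "?g y \<in> A" "f (?g y) = y" if "y \<in> B" for y
    using f(1) that by (auto simp: bij_betw_def inv_into_into f_inv_into_f)
  then show ?thesis
    unfolding poset_isomorphic_def
    using f bij_betw_inv_into[OF f(1)] by (intro exI[of _ ?g]) auto
qed

lemma poset_isomorphic_trans:
  assumes "poset_isomorphic A le_A B le_B" "poset_isomorphic B le_B D le_D"
  shows "poset_isomorphic A le_A D le_D"
proof -
  obtain f where f: "bij_betw f A B" "\<And>x y. x \<in> A \<Longrightarrow> y \<in> A \<Longrightarrow> le_A x y \<longleftrightarrow> le_B (f x) (f y)"
    using assms by (auto simp: poset_isomorphic_def)
  obtain g where g: "bij_betw g B D" "\<And>x y. x \<in> B \<Longrightarrow> y \<in> B \<Longrightarrow> le_B x y \<longleftrightarrow> le_D (g x) (g y)"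
    using assms by (auto simp: poset_isomorphic_def)
  have "f x \<in> B" if "x \<in> A" for x
    using f(1) that by (auto simp: bij_betw_def)
  then show ?thesis
    unfolding poset_isomorphic_def
    using f g bij_betw_trans[OF f(1) g(1)] by (intro exI[of _ "g \<circ> f"]) auto
qed

text \<open>Invariance under translation by \<open>V\<^sup>\<bottom>\<close>: these sets are the
  preimages of subsets of the quotient.\<close>

definition saturated :: "'a::euclidean_space set \<Rightarrow> 'a set \<Rightarrow> bool" where
  "saturated V T \<longleftrightarrow> (\<forall>x\<in>T. \<forall>z\<in>V\<^sup>\<bottom>. x + z \<in> T)"

text \<open>On saturated sets the inverse of taking unions of sets of cosets
  (\<open>Union_quot_set\<close>, \<open>quot_set_Union\<close>).\<close>

definition quot_set :: "'a::euclidean_space set \<Rightarrow> 'a set \<Rightarrow> 'a set set" where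
  "quot_set V T = {w \<in> qspace V. w \<subseteq> T}"

section \<open>Cosets and saturated sets\<close>

lemma perp_inner: "x \<in> V \<Longrightarrow> z \<in> V\<^sup>\<bottom> \<Longrightarrow> x \<bullet> z = 0"
  by (simp add: orthogonal_comp_def orthogonal_def)

lemma perp_add: "x \<in> V\<^sup>\<bottom> \<Longrightarrow> y \<in> V\<^sup>\<bottom> \<Longrightarrow> x + y \<in> V\<^sup>\<bottom>"
  by (rule subspace_add[OF subspace_orthogonal_comp])

lemma perp_diff: "x \<in> V\<^sup>\<bottom> \<Longrightarrow> y \<in> V\<^sup>\<bottom> \<Longrightarrow> x - y \<in> V\<^sup>\<bottom>"
  by (rule subspace_diff[OF subspace_orthogonal_comp])

lemma perp_0: "0 \<in> V\<^sup>\<bottom>"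
  by (rule subspace_0[OF subspace_orthogonal_comp])

lemma mem_if_perp_perp:
  fixes V :: "'a::euclidean_space set"
  assumes "subspace V" "\<And>z. z \<in> V\<^sup>\<bottom> \<Longrightarrow> x \<bullet> z = 0" shows "x \<in> V"
proof -
  have "x \<in> V\<^sup>\<bottom>\<^sup>\<bottom>"
    using assms(2) by (auto simp: orthogonal_comp_def orthogonal_def inner_commute)
  then show ?thesis
    by (simp add: orthogonal_comp_self[OF assms(1)])
qed

lemma perp_decomp:
  fixes x :: "'a::euclidean_space"
  assumes "subspace V" obtains v z where "v \<in> V" "z \<in> V\<^sup>\<bottom>" "x = v + z"
proof -
  have "x \<in> V + V\<^sup>\<bottom>"
    by (simp add: subspace_sum_orthogonal_comp[OF assms])
  then show thesis
    using that by (rule set_plus_elim)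
qed

lemma qclass_iff: "y \<in> qclass V x \<longleftrightarrow> y - x \<in> V\<^sup>\<bottom>"
proof
  assume "y - x \<in> V\<^sup>\<bottom>"
  then show "y \<in> qclass V x"
    unfolding qclass_def by (intro image_eqI[of _ _ "y - x"]) auto
qed (auto simp: qclass_def)

lemma qclass_self: "x \<in> qclass V x"
  by (simp add: qclass_iff perp_0)

lemma qclass_eqI:
  assumes "y \<in> qclass V x" shows "qclass V y = qclass V x"
proof -
  have yx: "y - x \<in> V\<^sup>\<bottom>"
    using assms by (simp add: qclass_iff)
  have "u - y \<in> V\<^sup>\<bottom> \<longleftrightarrow> u - x \<in> V\<^sup>\<bottom>" for u
    using perp_add[OF _ yx, of "u - y"] perp_diff[OF _ yx, of "u - x"] by auto
  then show ?thesis
    by (auto simp: qclass_iff)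
qed

lemma qspace_eq_qclass: "w \<in> qspace V \<Longrightarrow> x \<in> w \<Longrightarrow> w = qclass V x"
  using qclass_eqI by (auto simp: qspace_def)

lemma qclass_qspace: "qclass V x \<in> qspace V"
  by (simp add: qspace_def)

lemma qspaceE:
  assumes "w \<in> qspace V" obtains x where "w = qclass V x"
  using assms by (auto simp: qspace_def)

lemma qspace_subset_eqI:
  assumes "S \<subseteq> qspace V" "T \<subseteq> qspace V" "\<And>x. qclass V x \<in> S \<longleftrightarrow> qclass V x \<in> T"
  shows "S = T"
  using assms by (auto simp: qspace_def subset_iff)

lemma qclass_mem_quot_set:
  assumes "saturated V T" shows "qclass V x \<in> quot_set V T \<longleftrightarrow> x \<in> T"
proof
  assume "x \<in> T"
  then show "qclass V x \<in> quot_set V T"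
    using assms qclass_qspace[of V x] by (auto simp: quot_set_def saturated_def qclass_def)
qed (use qclass_self in \<open>auto simp: quot_set_def\<close>)

lemma Union_quot_set:
  assumes "saturated V T" shows "\<Union>(quot_set V T) = T"
proof
  show "T \<subseteq> \<Union>(quot_set V T)"
    using qclass_mem_quot_set[OF assms] qclass_self by blast
qed (auto simp: quot_set_def)

lemma saturated_Union:
  assumes "S \<subseteq> qspace V" shows "saturated V (\<Union>S)"
  unfolding saturated_def
proof (intro ballI)
  fix x z assume x: "x \<in> \<Union>S" and z: "z \<in> V\<^sup>\<bottom>"
  then obtain w where "w \<in> S" "w = qclass V x"
    using assms qspace_eq_qclass by blast
  then show "x + z \<in> \<Union>S"
    using z by (auto simp: qclass_iff)
qed

lemma quot_set_Union:
  assumes "S \<subseteq> qspace V" shows "quot_set V (\<Union>S) = S"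
proof
  show "quot_set V (\<Union>S) \<subseteq> S"
  proof
    fix w assume w: "w \<in> quot_set V (\<Union>S)"
    then obtain x where x: "w = qclass V x"
      by (auto simp: quot_set_def qspace_def)
    then have "x \<in> \<Union>S"
      using w qclass_self[of x V] x by (auto simp: quot_set_def)
    then show "w \<in> S"
      using assms qspace_eq_qclass x by blast
  qed
qed (use assms in \<open>auto simp: quot_set_def\<close>)

lemma quot_set_subset_qspace: "quot_set V T \<subseteq> qspace V"
  by (auto simp: quot_set_def)

lemma quot_set_subset_iff:
  assumes "saturated V T" "saturated V T'"
  shows "quot_set V T \<subseteq> quot_set V T' \<longleftrightarrow> T \<subseteq> T'"
proof
  assume "quot_set V T \<subseteq> quot_set V T'"
  then have "\<Union>(quot_set V T) \<subseteq> \<Union>(quot_set V T')"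
    by (rule Union_mono)
  then show "T \<subseteq> T'"
    by (simp add: Union_quot_set assms)
qed (auto simp: quot_set_def)

lemma quot_set_Int: "quot_set V T \<inter> quot_set V T' = quot_set V (T \<inter> T')"
  by (auto simp: quot_set_def)

lemma saturated_Int: "saturated V T \<Longrightarrow> saturated V T' \<Longrightarrow> saturated V (T \<inter> T')"
  by (auto simp: saturated_def)

text \<open>The union of a set of cosets is automatically saturated, so faces in the quotient can be
  exchanged for saturated faces of the preimage.\<close>

lemma cone_face_quot_set:
  assumes "saturated V K"
  shows "cone_face F (quot_set V K) \<longleftrightarrow>
    (\<exists>T. saturated V T \<and> F = quot_set V T \<and> T \<noteq> {} \<and> T face_of K)"
proof
  assume F: "cone_face F (quot_set V K)"
  then have "F \<subseteq> qspace V"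
    using quot_set_subset_qspace by (auto simp: cone_face_def)
  then have "saturated V (\<Union>F)" "F = quot_set V (\<Union>F)"
    by (simp_all add: saturated_Union quot_set_Union)
  moreover have "\<Union>F face_of K" "F \<noteq> {}"
    using F by (simp_all add: cone_face_def Union_quot_set[OF assms])
  moreover from this calculation(2) have "\<Union>F \<noteq> {}"
    using qclass_self by (force simp: quot_set_def qspace_def)
  ultimately show "\<exists>T. saturated V T \<and> F = quot_set V T \<and> T \<noteq> {} \<and> T face_of K"
    by blast
next
  assume "\<exists>T. saturated V T \<and> F = quot_set V T \<and> T \<noteq> {} \<and> T face_of K"
  then obtain T where T: "saturated V T" "F = quot_set V T" "T \<noteq> {}" "T face_of K"
    by blast
  then have "F \<noteq> {}"
    using qclass_mem_quot_set[OF T(1)] by blast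
  moreover have "F \<subseteq> quot_set V K"
    using T face_of_imp_subset by (auto simp: quot_set_def)
  ultimately show "cone_face F (quot_set V K)"
    using T by (simp add: cone_face_def Union_quot_set assms)
qed

text \<open>The chosen representative differs from \<open>x\<close> by a vector orthogonal to
  \<open>v\<close>. Writing points of U as \<open>x0 + v\<close> turns the pairing into the ambient
  inner product.\<close>

lemma pairing_qclass:
  assumes "v \<in> V" shows "pairing x0 (qclass V x) (x0 + v) = x \<bullet> v"
proof -
  have "(SOME y. y \<in> qclass V x) \<in> qclass V x"
    by (rule someI[of _ x]) (rule qclass_self)
  then have "v \<bullet> ((SOME y. y \<in> qclass V x) - x) = 0"
    using perp_inner[OF assms] by (simp add: qclass_iff)
  then show ?thesis
    by (simp add: pairing_def inner_diff_right inner_commute)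
qed

section \<open>Normal fans in the quotient\<close>

lemma saturated_ncone:
  assumes "P \<subseteq> V" "F \<subseteq> V" shows "saturated V (ncone P F)"
proof -
  have "z \<bullet> v = 0" if "z \<in> V\<^sup>\<bottom>" "v \<in> P \<union> F" for z v
    using perp_inner[of v V z] that assms by (auto simp: inner_commute)
  then show ?thesis
    by (auto simp: saturated_def ncone_def inner_add_left)
qed

lemma normal_cone_translate:
  assumes "P \<subseteq> V" "F \<subseteq> P"
  shows "normal_cone V x0 ((+) x0 ` P) ((+) x0 ` F) = quot_set V (ncone P F)"
proof -
  have sat: "saturated V (ncone P F)"
    using assms by (intro saturated_ncone) auto
  have "qclass V x \<in> normal_cone V x0 ((+) x0 ` P) ((+) x0 ` F) \<longleftrightarrow>
      qclass V x \<in> quot_set V (ncone P F)" for x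
    using assms unfolding qclass_mem_quot_set[OF sat]
    by (auto simp: normal_cone_def ncone_def qclass_qspace pairing_qclass subset_iff)
  moreover have "normal_cone V x0 ((+) x0 ` P) ((+) x0 ` F) \<subseteq> qspace V"
    by (auto simp: normal_cone_def)
  ultimately show ?thesis
    by (intro qspace_subset_eqI[OF _ quot_set_subset_qspace])
qed

lemma nonempty_faces_translate:
  "nonempty_faces ((+) x0 ` P) = (`) ((+) x0) ` {F. F face_of P \<and> F \<noteq> {}}"
proof (intro equalityI subsetI)
  fix F assume F: "F \<in> nonempty_faces ((+) x0 ` P)"
  have "F = (+) x0 ` ((+) (- x0) ` F)"
    by (auto simp: image_image)
  moreover have "(+) (- x0) ` F face_of P" "(+) (- x0) ` F \<noteq> {}"
    using F face_of_translation_eq[of x0 "(+) (- x0) ` F" P]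
    by (auto simp: nonempty_faces_def image_image)
  ultimately show "F \<in> (`) ((+) x0) ` {F. F face_of P \<and> F \<noteq> {}}"
    by blast
qed (auto simp: nonempty_faces_def)

lemma normal_fan_translate:
  assumes "P \<subseteq> V"
  shows "normal_fan V x0 ((+) x0 ` P) =
    (\<lambda>F. quot_set V (ncone P F)) ` {F. F face_of P \<and> F \<noteq> {}}"
  unfolding normal_fan_def nonempty_faces_translate image_image
proof (rule image_cong)
  fix F assume "F \<in> {F. F face_of P \<and> F \<noteq> {}}"
  then have "F \<subseteq> P"
    using face_of_imp_subset by blast
  then show "normal_cone V x0 ((+) x0 ` P) ((+) x0 ` F) = quot_set V (ncone P F)"
    by (rule normal_cone_translate[OF assms])
qed simp

text \<open>Such maps descend to the quotient, and they are determined there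
  (\<open>quot_act_inj\<close>).\<close>

definition perp_fixing :: "'a::euclidean_space set \<Rightarrow> ('a \<Rightarrow> 'a) \<Rightarrow> bool" where
  "perp_fixing V g \<longleftrightarrow> orthogonal_transformation g \<and> (\<forall>z\<in>V\<^sup>\<bottom>. g z = z)"

text \<open>Restricted to \<open>qspace V\<close> because elements of \<open>BijGroup\<close> are
  extensional functions.\<close>

definition quot_act :: "'a::euclidean_space set \<Rightarrow> ('a \<Rightarrow> 'a) \<Rightarrow> 'a set \<Rightarrow> 'a set" where
  "quot_act V g = (\<lambda>w\<in>qspace V. g ` w)"

section \<open>The group action on the quotient\<close>

lemma perp_fixing_hrefl_word:
  assumes "ns \<in> lists N" "N \<subseteq> V" shows "perp_fixing V (hrefl_word ns)"
proof -
  have "hrefl_word ns z = z" if "z \<in> V\<^sup>\<bottom>" for z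
    using assms(1)
  proof (induction ns)
    case (Cons n ns)
    then have "n \<bullet> z = 0"
      using assms(2) that perp_inner by blast
    then show ?case
      using Cons by (simp add: hrefl_orthogonal)
  qed simp
  then show ?thesis
    by (simp add: perp_fixing_def orthogonal_transformation_hrefl_word)
qed

lemma perp_fixing_linear: "perp_fixing V g \<Longrightarrow> linear g"
  by (simp add: perp_fixing_def orthogonal_transformation_linear)

lemma perp_fixing_inner: "perp_fixing V g \<Longrightarrow> g x \<bullet> g y = x \<bullet> y"
  by (simp add: perp_fixing_def orthogonal_transformation_def)

lemma quot_act_qclass:
  assumes "perp_fixing V g" shows "quot_act V g (qclass V x) = qclass V (g x)"
proof -
  have "g (x + z) = g x + z" if "z \<in> V\<^sup>\<bottom>" for z
    using assms that linear_add[OF perp_fixing_linear[OF assms]] by (simp add: perp_fixing_def)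
  then have "g ` qclass V x = qclass V (g x)"
    by (auto simp: qclass_def image_iff)
  then show ?thesis
    by (simp add: quot_act_def qclass_qspace)
qed

lemma perp_fixing_diff_mem:
  assumes "subspace V" "perp_fixing V g" shows "g x - x \<in> V"
proof (rule mem_if_perp_perp[OF assms(1)])
  fix z assume "z \<in> V\<^sup>\<bottom>"
  then have "g z = z"
    using assms by (simp add: perp_fixing_def)
  then show "(g x - x) \<bullet> z = 0"
    using perp_fixing_inner[OF assms(2), of x z] by (simp add: inner_diff_left)
qed

lemma perp_fixing_mem:
  assumes "subspace V" "perp_fixing V g" "x \<in> V" shows "g x \<in> V"
  using subspace_add[OF assms(1) perp_fixing_diff_mem[OF assms(1,2), of x] assms(3)] by simp

text \<open>The difference \<open>g x - h x\<close> lies in \<open>V\<^sup>\<bottom>\<close> by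
  equality of the induced maps, and in \<open>V\<close> because both maps move points only within
  \<open>V\<close>. This lifts finiteness from \<open>refl_group\<close> to the group of
  words.\<close>

lemma quot_act_inj:
  assumes V: "subspace V" and g: "perp_fixing V g" and h: "perp_fixing V h"
    and eq: "quot_act V g = quot_act V h"
  shows "g = h"
proof
  fix x
  have "qclass V (g x) = qclass V (h x)"
    using quot_act_qclass[OF g, of x] quot_act_qclass[OF h, of x] eq by simp
  then have 1: "g x - h x \<in> V\<^sup>\<bottom>"
    using qclass_self qclass_iff by blast
  have "(g x - x) - (h x - x) \<in> V"
    by (rule subspace_diff[OF V perp_fixing_diff_mem[OF V g] perp_fixing_diff_mem[OF V h]])
  then have "g x - h x \<in> V"
    by simp
  then show "g x = h x"
    using perp_inner[OF _ 1, of "g x - h x"] by simp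
qed

lemma quot_act_comp:
  assumes "perp_fixing V g" "perp_fixing V h"
  shows "compose (qspace V) (quot_act V g) (quot_act V h) = quot_act V (g \<circ> h)"
proof
  fix w
  show "compose (qspace V) (quot_act V g) (quot_act V h) w = quot_act V (g \<circ> h) w"
  proof (cases "w \<in> qspace V")
    case True
    then obtain x where "w = qclass V x"
      by (rule qspaceE)
    moreover have "h ` qclass V x \<in> qspace V"
      using quot_act_qclass[OF assms(2), of x] by (simp add: quot_act_def qclass_qspace)
    ultimately show ?thesis
      by (simp add: compose_def quot_act_def qclass_qspace image_comp)
  qed (auto simp: compose_def quot_act_def)
qed

lemma quot_act_id: "quot_act V id = (\<lambda>w\<in>qspace V. w)"
  by (auto simp: quot_act_def)

lemma quot_act_Bij:
  assumes g: "perp_fixing V g" and h: "perp_fixing V h" and inv: "h \<circ> g = id" "g \<circ> h = id"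
  shows "quot_act V g \<in> Bij (qspace V)"
proof -
  have maps: "quot_act V f w \<in> qspace V" if f: "perp_fixing V f" and w: "w \<in> qspace V" for f w
    using w quot_act_qclass[OF f] by (metis qspaceE qclass_qspace)
  have cancel: "quot_act V f (quot_act V k w) = w" if "perp_fixing V f" "perp_fixing V k" "f \<circ> k = id"
      "w \<in> qspace V" for f k w
    using fun_cong[OF quot_act_comp[OF that(1,2)], of w] that(3,4)
    by (simp add: compose_def quot_act_id)
  have "bij_betw (quot_act V g) (qspace V) (qspace V)"
    by (rule bij_betw_byWitness[of _ "quot_act V h"]) (use maps cancel g h inv in auto)
  then show ?thesis
    by (simp add: Bij_def quot_act_def)
qed

text \<open>The normal picked by \<open>SOME\<close> is a nonzero multiple of \<open>n\<close>, and
  reflections do not see scaling.\<close>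

lemma reflection_eq:
  assumes m: "m \<in> normals H" and par: "\<And>m. m \<in> normals H \<Longrightarrow> \<exists>c. c \<noteq> 0 \<and> m = c *\<^sub>R n"
  shows "reflection V H = quot_act V (hrefl n)"
proof -
  have "(SOME m. m \<in> normals H) \<in> normals H"
    using m by (rule someI)
  then obtain c where "c \<noteq> 0" "(SOME m. m \<in> normals H) = c *\<^sub>R n"
    using par by blast
  then have "hrefl (SOME m. m \<in> normals H) = hrefl n"
    by (simp add: hrefl_scaleR)
  moreover have "reflection V H = quot_act V (hrefl (SOME m. m \<in> normals H))"
    by (simp add: reflection_def quot_act_def hrefl_def Let_def)
  ultimately show ?thesis
    by simp
qed

text \<open>Concatenation and reversal of words realize product and inverse in
  \<open>BijGroup\<close>; a one-letter word is its own reverse, so generators need no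
  inverses.\<close>

lemma refl_group_eq:
  assumes V: "\<nu> ` \<H> \<subseteq> V" and refl: "\<And>H. H \<in> \<H> \<Longrightarrow> reflection V H = quot_act V (hrefl (\<nu> H))"
  shows "refl_group V \<H> = quot_act V ` hrefl_word ` lists (\<nu> ` \<H>)"
proof -
  let ?B = "BijGroup (qspace V)" and ?L = "lists (\<nu> ` \<H>)"
  have fix_word: "perp_fixing V (hrefl_word ns)" if "ns \<in> ?L" for ns
    using perp_fixing_hrefl_word that V by blast
  have rev_L: "rev ns \<in> ?L" if "ns \<in> ?L" for ns
    using that by (simp add: lists_eq_set)
  have Bij: "quot_act V (hrefl_word ns) \<in> Bij (qspace V)" if "ns \<in> ?L" for ns
  proof (rule quot_act_Bij)
    show "hrefl_word (rev ns) \<circ> hrefl_word ns = id"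
      by (simp add: fun_eq_iff hrefl_word_rev)
    show "hrefl_word ns \<circ> hrefl_word (rev ns) = id"
      using hrefl_word_rev[of "rev ns"] by (simp add: fun_eq_iff)
    show "perp_fixing V (hrefl_word (rev ns))"
      by (rule fix_word[OF rev_L[OF that]])
  qed (rule fix_word[OF that])
  have mult: "quot_act V (hrefl_word ns) \<otimes>\<^bsub>?B\<^esub> quot_act V (hrefl_word ms)
      = quot_act V (hrefl_word (ns @ ms))" if "ns \<in> ?L" "ms \<in> ?L" for ns ms
    using that Bij quot_act_comp[OF fix_word fix_word] by (simp add: BijGroup_def hrefl_word_append)
  have one: "quot_act V (hrefl_word []) = \<one>\<^bsub>?B\<^esub>"
    by (simp add: BijGroup_def quot_act_id)
  have word1: "hrefl_word [\<nu> H] = hrefl (\<nu> H)" for H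
    by auto
  have inv: "inv\<^bsub>?B\<^esub> quot_act V (hrefl_word ns) = quot_act V (hrefl_word (rev ns))" if "ns \<in> ?L" for ns
  proof (rule group.inv_equality[OF group_BijGroup])
    have "quot_act V (hrefl_word (rev ns @ ns)) = quot_act V id"
      by (rule arg_cong[of _ _ "quot_act V"]) (simp add: fun_eq_iff hrefl_word_append hrefl_word_rev)
    then show "quot_act V (hrefl_word (rev ns)) \<otimes>\<^bsub>?B\<^esub> quot_act V (hrefl_word ns) = \<one>\<^bsub>?B\<^esub>"
      using mult[OF rev_L[OF that] that] one by simp
    show "quot_act V (hrefl_word ns) \<in> carrier ?B" "quot_act V (hrefl_word (rev ns)) \<in> carrier ?B"
      using Bij[OF that] Bij[OF rev_L[OF that]] by (simp_all add: BijGroup_def)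
  qed
  show ?thesis
  proof (intro equalityI subsetI)
    fix g assume "g \<in> refl_group V \<H>"
    then have "g \<in> generate ?B (reflection V ` \<H>)"
      by (simp add: refl_group_def)
    then show "g \<in> quot_act V ` hrefl_word ` ?L"
    proof induction
      case one
      then show ?case
        by (metis \<open>quot_act V (hrefl_word []) = \<one>\<^bsub>?B\<^esub>\<close> image_eqI lists.Nil)
    next
      case (incl h)
      then obtain H where H: "H \<in> \<H>" "h = quot_act V (hrefl_word [\<nu> H])"
        using refl word1 by auto
      then have "[\<nu> H] \<in> ?L"
        by simp
      then show ?case
        using H by blast
    next
      case (inv h)
      then obtain H where H: "H \<in> \<H>" "h = quot_act V (hrefl_word [\<nu> H])"
        using refl word1 by auto
      then have L: "[\<nu> H] \<in> ?L"
        by simp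
      then have "inv\<^bsub>?B\<^esub> h = quot_act V (hrefl_word [\<nu> H])"
        using \<open>\<And>ns. ns \<in> ?L \<Longrightarrow> inv\<^bsub>?B\<^esub> quot_act V (hrefl_word ns) = quot_act V (hrefl_word (rev ns))\<close>[of "[\<nu> H]"]
          H(2) by simp
      then show ?case
        using L by blast
    next
      case (eng h1 h2)
      then obtain ns ms where "ns \<in> ?L" "ms \<in> ?L" "h1 = quot_act V (hrefl_word ns)"
          "h2 = quot_act V (hrefl_word ms)"
        by blast
      then have "ns @ ms \<in> ?L" "h1 \<otimes>\<^bsub>?B\<^esub> h2 = quot_act V (hrefl_word (ns @ ms))"
        using mult by auto
      then show ?case
        by blast
    qed
  next
    fix g assume "g \<in> quot_act V ` hrefl_word ` ?L"
    then obtain ns where ns: "ns \<in> ?L" "g = quot_act V (hrefl_word ns)"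
      by blast
    have "quot_act V (hrefl_word ns) \<in> generate ?B (reflection V ` \<H>)"
      using ns(1)
    proof (induction ns)
      case Nil
      then show ?case
        unfolding one by (rule generate.one)
    next
      case (Cons n ns)
      then obtain H where H: "H \<in> \<H>" "n = \<nu> H"
        by blast
      then have "quot_act V (hrefl_word [n]) \<in> generate ?B (reflection V ` \<H>)"
        using refl[OF H(1)] word1 by (metis generate.incl image_eqI)
      then have "quot_act V (hrefl_word [n]) \<otimes>\<^bsub>?B\<^esub> quot_act V (hrefl_word ns)
          \<in> generate ?B (reflection V ` \<H>)"
        using Cons.IH by (rule generate.eng)
      moreover have "[n] \<in> ?L"
        using Cons.hyps by simp
      ultimately show ?case
        using mult[of "[n]" ns] Cons.hyps by (simp del: hrefl_word.simps)
    qed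
    then show "g \<in> refl_group V \<H>"
      by (simp add: refl_group_def ns)
  qed
qed

text \<open>Rewrites the conditions \<open>g^-1 \<eta> = F\<close> of \<open>GR_le\<close> as
  \<open>\<eta> = g F\<close>. The group inverse is the inverse function only on \<open>S\<close>,
  whence the two inclusions.\<close>

lemma BijGroup_inv_image_iff:
  assumes "g \<in> Bij S" "A \<subseteq> S" "B \<subseteq> S"
  shows "(inv\<^bsub>BijGroup S\<^esub> g) ` A = B \<longleftrightarrow> A = g ` B"
proof -
  have bij: "bij_betw g S S"
    using assms by (simp add: Bij_def)
  have eq: "(inv\<^bsub>BijGroup S\<^esub> g) ` X = inv_into S g ` X" if "X \<subseteq> S" for X
    using that by (intro image_cong) (auto simp: inv_BijGroup[OF assms(1)])
  have "g ` inv_into S g ` A = A"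
    using bij assms(2) by (simp add: bij_betw_def image_inv_into_cancel)
  moreover have "inv_into S g ` g ` B = B"
    using bij assms(3) by (simp add: bij_betw_def inv_into_image_cancel)
  ultimately show ?thesis
    by (auto simp: eq[OF assms(2)])
qed

section \<open>Hyperplanes and chambers in terms of normals\<close>

lemma linear_hyperplane_normals:
  assumes V: "subspace V" and H: "linear_hyperplane V H"
  shows "normals H \<noteq> {}"
    and "n \<in> normals H \<Longrightarrow> \<Union>H = {x. n \<bullet> x = 0}"
    and "n \<in> normals H \<Longrightarrow> n \<in> V"
    and "n \<in> normals H \<Longrightarrow> m \<in> normals H \<Longrightarrow> \<exists>c. c \<noteq> 0 \<and> m = c *\<^sub>R n"
proof -
  have S: "subspace (\<Union>H)" "dim (\<Union>H) + 1 = DIM('a)" "H \<subseteq> qspace V"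
    using H by (auto simp: linear_hyperplane_def)
  obtain a where a: "a \<noteq> 0" "span (\<Union>H) \<subseteq> {x. a \<bullet> x = 0}"
    using lowdim_subset_hyperplane[of "\<Union>H"] S(2) by auto
  then have "a \<in> normals H"
    using span_superset[of "\<Union>H"]
    by (auto simp: normals_def orthogonal_comp_def orthogonal_def inner_commute)
  then show "normals H \<noteq> {}"
    by blast
  show eq: "\<Union>H = {x. n \<bullet> x = 0}" if n: "n \<in> normals H" for n
  proof (rule subspace_dim_equal)
    show "\<Union>H \<subseteq> {x. n \<bullet> x = 0}"
      using n by (auto simp: normals_def orthogonal_comp_def orthogonal_def inner_commute)
    show "dim {x. n \<bullet> x = 0} \<le> dim (\<Union>H)"
      using n S(2) dim_hyperplane[of n] by (simp add: normals_def)
  qed (use S subspace_hyperplane in auto)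
  \<comment> \<open>The coset containing 0 is \<open>V\<^sup>\<bottom>\<close> itself, so every
    normal is orthogonal to it and lies in \<open>V\<close>.\<close>
  obtain w where w: "w \<in> H" "0 \<in> w"
    using subspace_0[OF S(1)] by blast
  then have "w = qclass V 0"
    using S(3) qspace_eq_qclass by blast
  then have perp: "V\<^sup>\<bottom> \<subseteq> \<Union>H"
    using w by (auto simp: qclass_iff)
  show "n \<in> V" if n: "n \<in> normals H"
    by (rule mem_if_perp_perp[OF V]) (use perp eq[OF n] in auto)
  show "\<exists>c. c \<noteq> 0 \<and> m = c *\<^sub>R n" if n: "n \<in> normals H" and m: "m \<in> normals H"
  proof -
    \<comment> \<open>\<open>d\<close> is the part of \<open>m\<close> orthogonal to
      \<open>n\<close>. It lies in the hyperplane, hence is orthogonal to \<open>m\<close> as well,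
      and so to itself.\<close>
    define c where "c = (m \<bullet> n) / (n \<bullet> n)"
    define d where "d = m - c *\<^sub>R n"
    have nz: "n \<noteq> 0" "m \<noteq> 0"
      using n m by (auto simp: normals_def)
    have nd: "n \<bullet> d = 0"
      using nz by (simp add: d_def c_def inner_diff_right inner_commute)
    then have "m \<bullet> d = 0"
      using eq[OF n] eq[OF m] by blast
    then have "d \<bullet> d = 0"
      using nd by (simp add: d_def inner_diff_left)
    then have "m = c *\<^sub>R n"
      by (simp add: d_def)
    then show ?thesis
      using nz by (intro exI[of _ c]) auto
  qed
qed

lemma saturated_polar_cone:
  assumes "A \<subseteq> V" shows "saturated V (polar_cone A)"
proof -
  have "a \<bullet> z = 0" if "z \<in> V\<^sup>\<bottom>" "a \<in> A" for z a
    using perp_inner[of a V z] that assms by auto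
  then show ?thesis
    by (auto simp: saturated_def polar_cone_def inner_add_right)
qed

lemma saturated_tight_face:
  assumes "A \<subseteq> V" shows "saturated V (tight_face A w)"
proof -
  have "a \<bullet> z = 0" if "z \<in> V\<^sup>\<bottom>" "a \<in> A" for z a
    using perp_inner[of a V z] that assms by auto
  then show ?thesis
    by (auto simp: saturated_def tight_face_def polar_cone_def inner_add_right)
qed

lemma qclass_mem_iff:
  assumes "S \<subseteq> qspace V" shows "qclass V x \<in> S \<longleftrightarrow> x \<in> \<Union>S"
  using qclass_mem_quot_set[OF saturated_Union[OF assms]] quot_set_Union[OF assms] by metis

text \<open>A cone of the fan may prescribe some hyperplanes as equations. Pushing a relative
  interior point off all hyperplanes gives a point \<open>c\<close> whose signs select only
  half-spaces; the cone they cut out contains \<Phi>, and maximality makes it equal to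
  \<Phi>.\<close>

lemma chamber_normals:
  fixes V :: "'a::euclidean_space set"
  assumes V: "subspace V" and fin: "finite \<H>"
    and hyp: "\<And>H. H \<in> \<H> \<Longrightarrow> linear_hyperplane V H" and ch: "chamber V \<H> \<Phi>"
  obtains \<nu> c where "\<forall>H\<in>\<H>. \<nu> H \<in> normals H \<and> norm (\<nu> H) = 1 \<and> 0 < \<nu> H \<bullet> c"
    "\<Phi> = quot_set V {x. \<forall>H\<in>\<H>. 0 \<le> \<nu> H \<bullet> x}"
proof -
  note nrm = linear_hyperplane_normals[OF V hyp]
  obtain k where k: "\<Phi> = qspace V \<inter> (\<Inter>H\<in>\<H>. k H)"
      "\<And>H. H \<in> \<H> \<Longrightarrow> k H = H \<or> k H \<in> halfspaces V H"
    using ch by (auto simp: chamber_def arrangement_fan_def)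
  have half: "halfspaces V H = {quot_set V {x. 0 \<le> x \<bullet> n} | n. n \<in> normals H}" for H
    unfolding halfspaces_def quot_set_def by (auto simp: subset_iff)
  have "\<exists>n. n \<in> normals H \<and> (k H = H \<or> k H = quot_set V {x. 0 \<le> x \<bullet> n})" if H: "H \<in> \<H>" for H
    using k(2)[OF H] nrm(1)[OF H] unfolding half by blast
  then obtain m where m: "\<And>H. H \<in> \<H> \<Longrightarrow> m H \<in> normals H"
      "\<And>H. H \<in> \<H> \<Longrightarrow> k H = H \<or> k H = quot_set V {x. 0 \<le> x \<bullet> m H}"
    by metis
  have mV: "m H \<in> V" and mnz: "m H \<noteq> 0" and UH: "\<Union>H = {x. m H \<bullet> x = 0}" if "H \<in> \<H>" for H
    using nrm(2,3)[OF that m(1)[OF that]] m(1)[OF that] by (auto simp: normals_def)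
  \<comment> \<open>A prescribed equation is encoded by two opposite inequalities.\<close>
  define A where "A = m ` \<H> \<union> (\<lambda>H. - m H) ` {H \<in> \<H>. k H = H}"
  have finA: "finite A"
    using fin by (simp add: A_def)
  have AV: "A \<subseteq> V"
    using mV subspace_neg[OF V] by (auto simp: A_def)
  have mem_k: "qclass V x \<in> k H \<longleftrightarrow> (if k H = H then m H \<bullet> x = 0 else 0 \<le> m H \<bullet> x)"
    if H: "H \<in> \<H>" for H x
  proof (cases "k H = H")
    case True
    have "H \<subseteq> qspace V"
      using hyp[OF H] by (simp add: linear_hyperplane_def)
    then show ?thesis
      using True qclass_mem_iff[of H V x] UH[OF H] by simp
  next
    case False
    have "saturated V (polar_cone {m H})"
      using mV[OF H] by (intro saturated_polar_cone) auto
    moreover have "polar_cone {m H} = {x. 0 \<le> x \<bullet> m H}"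
      by (simp add: polar_cone_def inner_commute)
    ultimately have "qclass V x \<in> quot_set V {x. 0 \<le> x \<bullet> m H} \<longleftrightarrow> 0 \<le> x \<bullet> m H"
      using qclass_mem_quot_set[of V "{x. 0 \<le> x \<bullet> m H}" x] by simp
    moreover have "k H = quot_set V {x. 0 \<le> x \<bullet> m H}"
      using False m(2)[OF H] by blast
    ultimately show ?thesis
      using False by (simp only: if_False inner_commute[of x])
  qed
  have PhiA: "\<Phi> = quot_set V (polar_cone A)"
  proof (rule qspace_subset_eqI[OF _ quot_set_subset_qspace])
    show "\<Phi> \<subseteq> qspace V"
      using k by blast
    show "qclass V x \<in> \<Phi> \<longleftrightarrow> qclass V x \<in> quot_set V (polar_cone A)" for x
    proof -
      have "qclass V x \<in> \<Phi> \<longleftrightarrow> (\<forall>H\<in>\<H>. if k H = H then m H \<bullet> x = 0 else 0 \<le> m H \<bullet> x)"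
        unfolding k(1) using mem_k by (simp add: qclass_qspace)
      also have "\<dots> \<longleftrightarrow> (\<forall>H\<in>\<H>. 0 \<le> m H \<bullet> x \<and> (k H = H \<longrightarrow> m H \<bullet> x \<le> 0))"
        by (intro ball_cong refl) auto
      also have "\<dots> \<longleftrightarrow> x \<in> polar_cone A"
        by (simp add: A_def polar_cone_def ball_Un) blast
      finally show ?thesis
        by (simp add: qclass_mem_quot_set[OF saturated_polar_cone[OF AV]])
    qed
  qed
  \<comment> \<open>The cone as a face of itself: the resulting \<open>w\<close> satisfies with
    equality only those inequalities that are equations on the whole cone.\<close>
  have "polar_cone A face_of polar_cone A" "polar_cone A \<noteq> {}"
    using face_of_refl[OF convex_polar_cone] by (auto simp: polar_cone_def intro: exI[of _ 0])
  then obtain w where w: "w \<in> polar_cone A" "polar_cone A = tight_face A w"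
    using face_eq_tight_face[OF finA] by metis
  obtain z where z: "\<And>H. H \<in> \<H> \<Longrightarrow> m H \<bullet> z \<noteq> 0"
  proof (rule generic_point[of "m ` \<H>" UNIV])
    show "0 \<notin> m ` \<H>"
      using mnz by force
  qed (use fin in auto)
  obtain e :: real where e0: "0 < e"
      and e: "\<And>a. a \<in> m ` \<H> \<Longrightarrow> 0 < a \<bullet> w \<Longrightarrow> 0 < a \<bullet> (w + e *\<^sub>R z)"
    using perturb_pos[of "m ` \<H>"] fin by blast
  define c where "c = w + e *\<^sub>R z"
  have w_cases: "0 < m H \<bullet> w \<or> m H \<bullet> w = 0" if "H \<in> \<H>" for H
  proof -
    have "m H \<in> A"
      using that by (simp add: A_def)
    then have "0 \<le> m H \<bullet> w"
      using w(1) by (simp add: polar_cone_def)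
    then show ?thesis by auto
  qed
  have mc: "m H \<bullet> c \<noteq> 0" if H: "H \<in> \<H>" for H
    using w_cases[OF H] e[of "m H"] e0 z[OF H] H by (auto simp: c_def inner_add_right)
  \<comment> \<open>The unit normal on the side of \<open>c\<close>.\<close>
  define \<nu> where "\<nu> H = (sgn (m H \<bullet> c) / norm (m H)) *\<^sub>R m H" for H
  have \<nu>n: "\<nu> H \<in> normals H" if H: "H \<in> \<H>" for H
  proof -
    have "\<nu> H \<in> (\<Union>H)\<^sup>\<bottom>"
      unfolding \<nu>_def using m(1)[OF H]
      by (intro subspace_scale[OF subspace_orthogonal_comp]) (simp add: normals_def)
    then show ?thesis
      using mc[OF H] mnz[OF H] by (simp add: normals_def \<nu>_def sgn_zero_iff)
  qed
  have \<nu>1: "norm (\<nu> H) = 1" if H: "H \<in> \<H>" for H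
    using mc[OF H] mnz[OF H] by (simp add: \<nu>_def abs_sgn_eq)
  have \<nu>c: "0 < \<nu> H \<bullet> c" if H: "H \<in> \<H>" for H
    using mc[OF H] mnz[OF H] by (simp add: \<nu>_def sgn_real_def)
  let ?C = "{x. \<forall>H\<in>\<H>. 0 \<le> \<nu> H \<bullet> x}"
  have "polar_cone A \<subseteq> ?C"
  proof safe
    fix x H assume x: "x \<in> polar_cone A" and H: "H \<in> \<H>"
    have mA: "m H \<in> A"
      using H by (simp add: A_def)
    have "0 \<le> sgn (m H \<bullet> c) * (m H \<bullet> x)"
      using w_cases[OF H]
    proof
      assume "0 < m H \<bullet> w"
      then have "0 < m H \<bullet> c"
        using e[of "m H"] H by (simp add: c_def)
      then show ?thesis
        using x mA by (simp add: polar_cone_def)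
    next
      assume "m H \<bullet> w = 0"
      then have "m H \<bullet> x = 0"
        using x mA unfolding w(2) by (simp add: tight_face_def)
      then show ?thesis by simp
    qed
    then show "0 \<le> \<nu> H \<bullet> x"
      by (simp add: \<nu>_def)
  qed
  then have "\<Phi> \<subseteq> quot_set V ?C"
    unfolding PhiA by (auto simp: quot_set_def)
  moreover have "quot_set V ?C \<in> arrangement_fan V \<H>"
  proof -
    have "quot_set V ?C = qspace V \<inter> (\<Inter>H\<in>\<H>. quot_set V {x. 0 \<le> x \<bullet> \<nu> H})"
      unfolding quot_set_def by (auto simp: inner_commute subset_iff)
    moreover have "\<forall>H\<in>\<H>. quot_set V {x. 0 \<le> x \<bullet> \<nu> H} \<in> halfspaces V H"
      using \<nu>n unfolding half by blast
    ultimately show ?thesis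
      unfolding arrangement_fan_def by blast
  qed
  ultimately have "\<Phi> = quot_set V ?C"
    using ch by (auto simp: chamber_def)
  then show thesis
    using that[of \<nu> c] \<nu>n \<nu>1 \<nu>c by blast
qed

locale quotient_reflections = finite_reflections N c for N :: "'a::euclidean_space set" and c +
  fixes V :: "'a set"
  assumes subspace_V: "subspace V" and N_V: "N \<subseteq> V"
begin

section \<open>The refined fundamental fan and the isomorphism in the quotient\<close>

lemma G_perp_fixing: "g \<in> G \<Longrightarrow> perp_fixing V g"
  using perp_fixing_hrefl_word N_V by (auto simp: G_def)

lemma G_mem_V: "g \<in> G \<Longrightarrow> x \<in> V \<Longrightarrow> g x \<in> V"
  by (rule perp_fixing_mem[OF subspace_V G_perp_fixing])

lemma pos_V: "pos \<subseteq> V"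
  using G_mem_V N_V by (auto simp: pos_def roots_def)

lemma saturated_C: "saturated V C"
  unfolding C_polar by (rule saturated_polar_cone[OF pos_V])

lemma saturated_refined_cone:
  assumes "P \<subseteq> V" shows "saturated V (refined_cone P w)"
proof -
  have "max_face P (y + z) = max_face P y" if z: "z \<in> V\<^sup>\<bottom>" for y z
  proof -
    have "(y + z) \<bullet> p = y \<bullet> p" if "p \<in> P" for p
      using perp_inner[of p V z] that z assms by (auto simp: inner_add_left inner_commute[of z])
    then show ?thesis
      by (auto simp: max_face_def)
  qed
  moreover have "a \<bullet> (y + z) = a \<bullet> y" if "z \<in> V\<^sup>\<bottom>" "a \<in> pos" for a y z
    using perp_inner[of a V z] that pos_V by (auto simp: inner_add_right)
  ultimately show ?thesis
    using saturated_C by (auto simp: saturated_def refined_cone_def)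
qed

lemma saturated_G_image:
  assumes "g \<in> G" "saturated V T" shows "saturated V (g ` T)"
  unfolding saturated_def
proof safe
  fix x z assume "x \<in> T" and z: "z \<in> V\<^sup>\<bottom>"
  have "g z = z"
    using G_perp_fixing[OF assms(1)] z by (simp add: perp_fixing_def)
  then have "g x + z = g (x + z)"
    using linear_add[OF G_linear[OF assms(1)]] by metis
  then show "g x + z \<in> g ` T"
    using assms(2) \<open>x \<in> T\<close> z by (auto simp: saturated_def)
qed

lemma quot_act_quot_set:
  assumes g: "g \<in> G" and T: "saturated V T"
  shows "quot_act V g ` quot_set V T = quot_set V (g ` T)"
proof -
  have quot: "quot_set V S = qclass V ` S" if "saturated V S" for S
    using qclass_mem_quot_set[OF that] by (auto simp: quot_set_def qspace_def)
  show ?thesis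
    unfolding quot[OF T] quot[OF saturated_G_image[OF g T]] image_image
    using quot_act_qclass[OF G_perp_fixing[OF g]] by simp
qed

lemma quot_act_G_Bij: "g \<in> G \<Longrightarrow> quot_act V g \<in> Bij (qspace V)"
proof -
  assume g: "g \<in> G"
  obtain h where h: "h \<in> G" "\<And>x. h (g x) = x" "\<And>x. g (h x) = x"
    using G_inv g by metis
  show ?thesis
    by (rule quot_act_Bij[OF G_perp_fixing[OF g] G_perp_fixing[OF h(1)]]) (simp_all add: fun_eq_iff h)
qed

text \<open>Indexes the fan by points of \<open>C\<close>: each face of a cone \<sigma> \<inter>
  \<Phi> is the refined cone of one of its points, and the refined cone of \<open>w\<close> is a
  face for the \<sigma> belonging to the maximizers of \<open>w\<close>.\<close>

lemma FFan_eq: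
  assumes P: "polytope P" "P \<noteq> {}" "P \<subseteq> V"
  shows "FFan V x0 (quot_set V C) ((+) x0 ` P) = (\<lambda>w. quot_set V (refined_cone P w)) ` C"
proof -
  have "quot_set V (ncone P F) \<inter> quot_set V C = quot_set V (ncone P F \<inter> C)" for F
    by (rule quot_set_Int)
  then have "\<tau> \<in> FFan V x0 (quot_set V C) ((+) x0 ` P) \<longleftrightarrow>
    (\<exists>F. F face_of P \<and> F \<noteq> {} \<and> cone_face \<tau> (quot_set V (ncone P F \<inter> C)))" for \<tau>
    unfolding FFan_def normal_fan_translate[OF P(3)] by auto
  moreover have "saturated V (ncone P F \<inter> C)" if "F face_of P" for F
    using that P face_of_imp_subset
    by (intro saturated_Int saturated_ncone saturated_C) blast+
  ultimately have mem: "\<tau> \<in> FFan V x0 (quot_set V C) ((+) x0 ` P) \<longleftrightarrow>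
    (\<exists>F T. F face_of P \<and> F \<noteq> {} \<and> saturated V T \<and> \<tau> = quot_set V T \<and> T \<noteq> {} \<and>
      T face_of ncone P F \<inter> C)" for \<tau>
    using cone_face_quot_set by blast
  show ?thesis
  proof (intro equalityI subsetI)
    fix \<tau> assume "\<tau> \<in> FFan V x0 (quot_set V C) ((+) x0 ` P)"
    then obtain F T where FT: "F face_of P" "F \<noteq> {}" "\<tau> = quot_set V T" "T \<noteq> {}"
        "T face_of ncone P F \<inter> C"
      unfolding mem by blast
    obtain w where "w \<in> C" "T = refined_cone P w"
      by (rule face_refined_cone[OF P(1) FT(1,2,5,4)])
    then show "\<tau> \<in> (\<lambda>w. quot_set V (refined_cone P w)) ` C"
      using FT by blast
  next
    fix \<tau> assume "\<tau> \<in> (\<lambda>w. quot_set V (refined_cone P w)) ` C"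
    then obtain w where w: "w \<in> C" "\<tau> = quot_set V (refined_cone P w)"
      by blast
    have "max_face P w face_of P" "max_face P w \<noteq> {}"
      by (rule max_face_face_of[OF polytope_imp_convex[OF P(1)]])
        (rule max_face_nonempty[OF polytope_imp_compact[OF P(1)] P(2)])
    moreover have "refined_cone P w \<noteq> {}"
      using refined_cone_self[OF w(1)] by blast
    ultimately show "\<tau> \<in> FFan V x0 (quot_set V C) ((+) x0 ` P)"
      unfolding mem using refined_cone_face_of[OF P(1,2)] saturated_refined_cone[OF P(3)] w(2) by blast
  qed
qed

text \<open>A face of \<open>C\<close> containing the refined cone contains \<open>w\<close>, and
  \<open>tight_face pos w\<close> is the smallest face that does.\<close>

lemma min_face_eq:
  assumes "P \<subseteq> V" and w: "w \<in> C"
  shows "min_face (quot_set V C) (quot_set V (refined_cone P w)) = quot_set V (tight_face pos w)"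
  unfolding min_face_def
proof (rule Least_equality)
  have "tight_face pos w face_of C" "w \<in> tight_face pos w"
    unfolding C_polar using tight_face_face_of tight_face_self w C_polar by auto
  then have "cone_face (quot_set V (tight_face pos w)) (quot_set V C)"
    unfolding cone_face_quot_set[OF saturated_C] using saturated_tight_face[OF pos_V] by blast
  moreover have "quot_set V (refined_cone P w) \<subseteq> quot_set V (tight_face pos w)"
    using refined_cone_subset_tight_face by (auto simp: quot_set_def)
  ultimately show "cone_face (quot_set V (tight_face pos w)) (quot_set V C) \<and>
      quot_set V (refined_cone P w) \<subseteq> quot_set V (tight_face pos w)" ..
next
  fix F assume F: "cone_face F (quot_set V C) \<and> quot_set V (refined_cone P w) \<subseteq> F"
  then obtain T where T: "saturated V T" "F = quot_set V T" "T face_of C"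
    using cone_face_quot_set[OF saturated_C] by blast
  then have "refined_cone P w \<subseteq> T"
    using F quot_set_subset_iff[OF saturated_refined_cone[OF assms(1)] T(1)] by simp
  then have "w \<in> T"
    using refined_cone_self[OF w] by blast
  then have "tight_face pos w \<subseteq> T"
    using tight_face_least[OF finite_pos] T(3) by (simp add: C_polar)
  then show "quot_set V (tight_face pos w) \<subseteq> F"
    unfolding T by (auto simp: quot_set_def)
qed

lemma G_fix_tight_face:
  assumes "g \<in> G" "w \<in> C" "g w \<in> C" "y \<in> tight_face pos w" shows "g y = y"
proof (rule G_inner_eq[OF assms(1,2) c_reg])
  show "g w \<bullet> c = w \<bullet> c"
    by (simp add: G_fundamental[OF assms(1-3)])
  show "a \<bullet> y = 0" if "a \<in> pos" "a \<bullet> w = 0" for a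
    using assms(4) that by (simp add: tight_face_def)
qed

text \<open>The inverse of \<open>h\<close> composed with \<open>g\<close> sends \<open>w\<close>
  back into \<open>C\<close>, so it fixes the whole tight face of \<open>w\<close>.\<close>

lemma G_eq_on_tight_face:
  assumes g: "g \<in> G" and h: "h \<in> G" and w: "w \<in> C" and "g w \<in> h ` C"
    and y: "y \<in> tight_face pos w"
  shows "g y = h y"
proof -
  obtain k where k: "k \<in> G" "\<And>x. k (h x) = x" "\<And>x. h (k x) = x"
    using G_inv h by metis
  have "(k \<circ> g) w \<in> C"
    using assms(4) k(2) by auto
  then have "(k \<circ> g) y = y"
    by (rule G_fix_tight_face[OF G_comp[OF k(1) g] w _ y])
  then show ?thesis
    using k(3)[of "g y"] by simp
qed

text \<open>From left to right \<open>k = h\<close> works, as \<open>g\<close> and \<open>h\<close>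
  agree on the tight face of \<open>w\<close>. From right to left \<open>k\<close> may replace both
  \<open>g\<close> and \<open>h\<close>: equality of images of a tight face already forces pointwise
  agreement on it.\<close>

lemma image_refined_cone_subset_iff:
  assumes g: "g \<in> G" and h: "h \<in> G" and w: "w \<in> C" and v: "v \<in> C"
  shows "g ` refined_cone P w \<subseteq> h ` refined_cone P v \<longleftrightarrow>
    refined_cone P w \<subseteq> refined_cone P v \<and>
    (\<exists>k\<in>G. g ` tight_face pos w = k ` tight_face pos w \<and> h ` tight_face pos v = k ` tight_face pos v)"
proof
  assume sub: "g ` refined_cone P w \<subseteq> h ` refined_cone P v"
  have gw: "g w \<in> h ` C"
    using sub refined_cone_self[OF w, of P] refined_cone_subset_C[of P v] by blast
  have eq: "g y = h y" if "y \<in> tight_face pos w" for y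
    by (rule G_eq_on_tight_face[OF g h w gw that])
  have "inj h"
    using G_orth[OF h] orthogonal_transformation_inj by blast
  moreover have "h ` refined_cone P w \<subseteq> h ` refined_cone P v"
  proof -
    have "h ` refined_cone P w = g ` refined_cone P w"
      using eq refined_cone_subset_tight_face[of P w] by (intro image_cong) auto
    then show ?thesis
      using sub by simp
  qed
  ultimately have "refined_cone P w \<subseteq> refined_cone P v"
    by (simp add: inj_image_subset_iff)
  moreover have "g ` tight_face pos w = h ` tight_face pos w"
    using eq by (intro image_cong) auto
  ultimately show "refined_cone P w \<subseteq> refined_cone P v \<and>
    (\<exists>k\<in>G. g ` tight_face pos w = k ` tight_face pos w \<and> h ` tight_face pos v = k ` tight_face pos v)"
    using h by blast
next
  assume "refined_cone P w \<subseteq> refined_cone P v \<and>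
    (\<exists>k\<in>G. g ` tight_face pos w = k ` tight_face pos w \<and> h ` tight_face pos v = k ` tight_face pos v)"
  then obtain k where sub: "refined_cone P w \<subseteq> refined_cone P v" and k: "k \<in> G"
      "g ` tight_face pos w = k ` tight_face pos w" "h ` tight_face pos v = k ` tight_face pos v"
    by blast
  have eq: "f ` refined_cone P u = k ` refined_cone P u"
    if f: "f \<in> G" "f ` tight_face pos u = k ` tight_face pos u" and u: "u \<in> C" for f u
  proof (rule image_cong[OF refl])
    fix y assume y: "y \<in> refined_cone P u"
    have "u \<in> tight_face pos u" "tight_face pos u \<subseteq> C"
      using u by (auto simp: tight_face_def C_polar)
    then have "f u \<in> k ` C"
      using f(2) by blast
    then show "f y = k y"
      using G_eq_on_tight_face[OF f(1) k(1) u] y refined_cone_subset_tight_face by blast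
  qed
  show "g ` refined_cone P w \<subseteq> h ` refined_cone P v"
    unfolding eq[OF g k(2) w] eq[OF h k(3) v] using sub by blast
qed

lemma GR_isomorphic_normal_fan:
  assumes P: "polytope P" "P \<noteq> {}" "P \<subseteq> V" "P \<subseteq> reg"
    and group: "refl_group V \<H> = quot_act V ` G"
  shows "poset_isomorphic (GR V x0 \<H> (quot_set V C) ((+) x0 ` P)) (GR_le V \<H> (quot_set V C))
    (normal_fan V x0 ((+) x0 ` sym_hull P)) (\<subseteq>)"
proof (rule poset_isomorphic_paramI)
  let ?tf = "tight_face pos" and ?rc = "refined_cone P"
  let ?a = "\<lambda>(g, w). (quot_set V (?rc w), quot_set V (g ` ?tf w))"
  let ?b = "\<lambda>(g, w). quot_set V (g ` ?rc w)"
  note sat_tf = saturated_tight_face[OF pos_V] and sat_rc = saturated_refined_cone[OF P(3)]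
  show "GR V x0 \<H> (quot_set V C) ((+) x0 ` P) = ?a ` (G \<times> C)"
  proof -
    have "GR V x0 \<H> (quot_set V C) ((+) x0 ` P) =
      {(quot_set V (?rc w), quot_act V g ` quot_set V (?tf w)) | g w. g \<in> G \<and> w \<in> C}"
      unfolding GR_def FFan_eq[OF P(1-3)] group using min_face_eq[OF P(3)] by fastforce
    also have "\<dots> = (\<lambda>(g, w). (quot_set V (?rc w), quot_act V g ` quot_set V (?tf w))) ` (G \<times> C)"
      by auto
    also have "\<dots> = ?a ` (G \<times> C)"
      by (rule image_cong) (simp_all add: quot_act_quot_set sat_tf split_beta mem_Times_iff)
    finally show ?thesis .
  qed
  have "sym_hull P \<subseteq> V"
    unfolding sym_hull_def using G_mem_V P(3)
    by (intro hull_minimal subspace_imp_convex[OF subspace_V]) auto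
  then have "normal_fan V x0 ((+) x0 ` sym_hull P) =
      quot_set V ` (ncone (sym_hull P) ` {F. F face_of sym_hull P \<and> F \<noteq> {}})"
    by (simp add: normal_fan_translate image_image)
  then show "normal_fan V x0 ((+) x0 ` sym_hull P) = ?b ` (G \<times> C)"
    unfolding normal_cones_sym_hull[OF P(1,2,4)] by auto
  show iff: "GR_le V \<H> (quot_set V C) (?a i) (?a j) \<longleftrightarrow> ?b i \<subseteq> ?b j"
    if ij: "i \<in> G \<times> C" "j \<in> G \<times> C" for i j
  proof -
    obtain g w h v where gw: "i = (g, w)" "g \<in> G" "w \<in> C" and hv: "j = (h, v)" "h \<in> G" "v \<in> C"
      using ij by blast
    have inv: "(inv\<^bsub>BijGroup (qspace V)\<^esub> quot_act V k) ` quot_set V (f ` ?tf u) = quot_set V (?tf u) \<longleftrightarrow>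
        f ` ?tf u = k ` ?tf u" if kf: "k \<in> G" "f \<in> G" for k f u
    proof -
      note sat = saturated_G_image[OF _ sat_tf]
      have "(inv\<^bsub>BijGroup (qspace V)\<^esub> quot_act V k) ` quot_set V (f ` ?tf u) = quot_set V (?tf u) \<longleftrightarrow>
          quot_set V (f ` ?tf u) = quot_act V k ` quot_set V (?tf u)"
        by (rule BijGroup_inv_image_iff[OF quot_act_G_Bij[OF kf(1)]
            quot_set_subset_qspace quot_set_subset_qspace])
      also have "\<dots> \<longleftrightarrow> quot_set V (f ` ?tf u) = quot_set V (k ` ?tf u)"
        by (simp add: quot_act_quot_set[OF kf(1) sat_tf])
      also have "\<dots> \<longleftrightarrow> f ` ?tf u = k ` ?tf u"
        using Union_quot_set[OF sat[OF kf(1)], of u] Union_quot_set[OF sat[OF kf(2)], of u] by metis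
      finally show ?thesis .
    qed
    have "GR_le V \<H> (quot_set V C) (?a i) (?a j) \<longleftrightarrow> ?rc w \<subseteq> ?rc v \<and>
        (\<exists>k\<in>G. g ` ?tf w = k ` ?tf w \<and> h ` ?tf v = k ` ?tf v)"
      unfolding GR_le_def group gw(1) hv(1)
      by (simp add: min_face_eq[OF P(3)] gw hv inv quot_set_subset_iff[OF sat_rc sat_rc])
    also have "\<dots> \<longleftrightarrow> g ` ?rc w \<subseteq> h ` ?rc v"
      by (rule image_refined_cone_subset_iff[OF gw(2) hv(2) gw(3) hv(3), symmetric])
    also have "\<dots> \<longleftrightarrow> ?b i \<subseteq> ?b j"
      using gw hv by (simp add: quot_set_subset_iff saturated_G_image sat_rc)
    finally show ?thesis .
  qed
  \<comment> \<open>Equal refined cones have the same minimal face, and \<open>g\<close> and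
    \<open>h\<close> agree on it because \<open>g w\<close> lies in the chamber
    \<open>h C\<close>.\<close>
  show "?a i = ?a j" if ij: "i \<in> G \<times> C" "j \<in> G \<times> C"
    and le: "GR_le V \<H> (quot_set V C) (?a i) (?a j)" "GR_le V \<H> (quot_set V C) (?a j) (?a i)" for i j
  proof -
    obtain g w h v where gw: "i = (g, w)" "g \<in> G" "w \<in> C" and hv: "j = (h, v)" "h \<in> G" "v \<in> C"
      using ij by blast
    have "?b i \<subseteq> ?b j"
      using iff[OF ij] le(1) by (rule iffD1)
    moreover have "fst (?a i) \<subseteq> fst (?a j)"
      using le(1) unfolding GR_le_def by (rule conjunct1)
    moreover have "fst (?a j) \<subseteq> fst (?a i)"
      using le(2) unfolding GR_le_def by (rule conjunct1)
    ultimately have sub: "g ` ?rc w \<subseteq> h ` ?rc v" and rc: "quot_set V (?rc w) = quot_set V (?rc v)"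
      using gw hv by (simp_all add: quot_set_subset_iff saturated_G_image sat_rc subset_antisym)
    have "quot_set V (?tf w) = quot_set V (?tf v)"
      using min_face_eq[OF P(3)] gw(3) hv(3) rc by metis
    then have tf: "?tf w = ?tf v"
      using Union_quot_set[OF sat_tf, of w] Union_quot_set[OF sat_tf, of v] by metis
    have "g w \<in> h ` C"
      using sub refined_cone_self[OF gw(3), of P] refined_cone_subset_C[of P v] by blast
    then have "g ` ?tf w = h ` ?tf w"
      by (intro image_cong refl G_eq_on_tight_face[OF gw(2) hv(2) gw(3)])
    then show ?thesis
      using gw hv rc tf by simp
  qed
qed auto

lemma faces_isomorphic_normal_fan:
  assumes "polytope P" "P \<subseteq> V"
  shows "poset_isomorphic (nonempty_faces ((+) x0 ` P)) (\<subseteq>)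
    (normal_fan V x0 ((+) x0 ` P)) (\<lambda>x y. y \<subseteq> x)"
proof (rule poset_isomorphic_paramI)
  let ?I = "{F. F face_of P \<and> F \<noteq> {}}"
  show "nonempty_faces ((+) x0 ` P) = (`) ((+) x0) ` ?I"
    by (rule nonempty_faces_translate)
  show "normal_fan V x0 ((+) x0 ` P) = (\<lambda>F. quot_set V (ncone P F)) ` ?I"
    by (rule normal_fan_translate[OF assms(2)])
  show "(+) x0 ` F \<subseteq> (+) x0 ` F' \<longleftrightarrow> quot_set V (ncone P F') \<subseteq> quot_set V (ncone P F)"
    if F: "F \<in> ?I" "F' \<in> ?I" for F F'
  proof -
    have "F \<subseteq> V" "F' \<subseteq> V"
      using F assms(2) face_of_imp_subset by blast+
    then have "saturated V (ncone P F)" "saturated V (ncone P F')"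
      using saturated_ncone[OF assms(2)] by blast+
    then show ?thesis
      using ncone_subset_iff[OF assms(1), of F F'] F
      by (simp add: quot_set_subset_iff inj_image_subset_iff)
  qed
qed auto

end

text \<open>By orthogonality \<open>g x \<bullet> v = x \<bullet> h v\<close>, so the adjoint of
  \<open>g\<close> is its inverse \<open>h\<close>. A point of U is determined by its pairings with
  all cosets, which settles uniqueness for \<open>THE\<close>.\<close>

lemma right_act_quot_act:
  assumes "v \<in> V" and g: "perp_fixing V g" and h: "\<And>x. g (h x) = x" and hv: "h v \<in> V"
  shows "right_act V x0 (x0 + v) (quot_act V g) = x0 + h v"
  unfolding right_act_def
proof (rule the_equality)
  have "pairing x0 (quot_act V g (qclass V x)) (x0 + v) = pairing x0 (qclass V x) (x0 + h v)" for x
    using perp_fixing_inner[OF g, of x "h v"]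
    by (simp add: quot_act_qclass[OF g] pairing_qclass[OF assms(1)] pairing_qclass[OF hv] h)
  moreover have "x0 + h v \<in> dual_space V x0"
    using hv by (simp add: dual_space_def add.commute)
  ultimately show "x0 + h v \<in> dual_space V x0 \<and>
      (\<forall>w\<in>qspace V. pairing x0 (quot_act V g w) (x0 + v) = pairing x0 w (x0 + h v))"
    by (auto simp: qspace_def)
  fix u assume u: "u \<in> dual_space V x0 \<and>
      (\<forall>w\<in>qspace V. pairing x0 (quot_act V g w) (x0 + v) = pairing x0 w u)"
  then obtain t where t: "t \<in> V" "u = x0 + t"
    by (auto simp: dual_space_def add.commute)
  have "x \<bullet> t = x \<bullet> h v" for x
  proof -
    have "x \<bullet> t = pairing x0 (quot_act V g (qclass V x)) (x0 + v)"
      using u qclass_qspace[of V x] pairing_qclass[OF t(1), of x0 x] by (simp add: t(2))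
    also have "\<dots> = g x \<bullet> g (h v)"
      by (simp add: quot_act_qclass[OF g] pairing_qclass[OF assms(1)] h)
    finally show ?thesis
      by (simp add: perp_fixing_inner[OF g])
  qed
  then have "t = h v"
    using vector_eq_ldot[of t "h v"] by blast
  then show "u = x0 + h v"
    by (simp add: t)
qed

text \<open>Inversion permutes the group, so the orbit under the right action equals the orbit under
  \<open>G\<close> up to translation by \<open>x0\<close>.\<close>

lemma (in quotient_reflections) symmetrization_eq:
  assumes P: "P \<subseteq> V" and group: "refl_group V \<H> = quot_act V ` G"
  shows "symmetrization V x0 \<H> ((+) x0 ` P) = (+) x0 ` sym_hull P"
proof -
  have act: "\<exists>h\<in>G. right_act V x0 (x0 + v) (quot_act V g) = x0 + h v" if g: "g \<in> G" "v \<in> P" for g v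
  proof -
    obtain h where h: "h \<in> G" "\<And>x. h (g x) = x" "\<And>x. g (h x) = x"
      using G_inv g(1) by metis
    then show ?thesis
      using right_act_quot_act[OF _ G_perp_fixing[OF g(1)] h(3)] G_mem_V[OF h(1)] g(2) P by blast
  qed
  have act': "\<exists>g\<in>G. right_act V x0 (x0 + v) (quot_act V g) = x0 + h v" if h: "h \<in> G" "v \<in> P" for h v
  proof -
    obtain g where g: "g \<in> G" "\<And>x. g (h x) = x" "\<And>x. h (g x) = x"
      using G_inv h(1) by metis
    then show ?thesis
      using right_act_quot_act[OF _ G_perp_fixing[OF g(1)] g(2)] G_mem_V[OF h(1)] h(2) P by blast
  qed
  have "{right_act V x0 x g | x g. x \<in> (+) x0 ` P \<and> g \<in> refl_group V \<H>} =
      (+) x0 ` {g x | g x. g \<in> G \<and> x \<in> P}" (is "?L = ?R")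
  proof (intro equalityI subsetI)
    fix y assume "y \<in> ?L"
    then obtain v g where "v \<in> P" "g \<in> G" "y = right_act V x0 (x0 + v) (quot_act V g)"
      unfolding group by blast
    then show "y \<in> ?R"
      using act by blast
  next
    fix y assume "y \<in> ?R"
    then obtain v h where "v \<in> P" "h \<in> G" "y = x0 + h v"
      by blast
    moreover from this obtain g where "g \<in> G" "right_act V x0 (x0 + v) (quot_act V g) = x0 + h v"
      using act' by blast
    ultimately have "y = right_act V x0 (x0 + v) (quot_act V g)" "x0 + v \<in> (+) x0 ` P"
        "quot_act V g \<in> refl_group V \<H>"
      by (simp_all add: group)
    then show "y \<in> ?L"
      by blast
  qed
  then show ?thesis
    by (simp add: symmetrization_def sym_hull_def convex_hull_translation)
qed

text \<open>\<Psi> is a translate of \<open>V \<inter> C\<close>, usually not full-dimensional in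
  the ambient space, so only relative interiors are available. From a point \<open>y\<close> with
  all inequalities strict, the segment to \<open>x\<close> can be prolonged beyond \<open>x\<close>
  within \<open>C\<close>, which makes them strict at \<open>x\<close>.\<close>

lemma (in quotient_reflections) appropriate_reg:
  assumes x0: "x0 \<in> V\<^sup>\<bottom>" and P: "(+) x0 ` P \<subseteq> dual_space V x0"
    and app: "appropriate (dual_cone V x0 (quot_set V C)) ((+) x0 ` P)"
  shows "P \<subseteq> V" and "P \<subseteq> reg"
proof -
  have shift: "x0 + v \<in> C \<longleftrightarrow> v \<in> C" for v
  proof -
    have "n \<bullet> x0 = 0" if "n \<in> N" for n
      using perp_inner[OF _ x0] N_V that by blast
    then show ?thesis
      by (simp add: C_def inner_add_right)
  qed
  show PV: "P \<subseteq> V"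
    using P by (auto simp: dual_space_def add.commute)
  have "dual_cone V x0 (quot_set V C) = (+) x0 ` (V \<inter> C)"
  proof -
    have "dual_cone V x0 (quot_set V C) = {u \<in> dual_space V x0. u \<in> C}"
      by (simp add: dual_cone_def qclass_mem_quot_set[OF saturated_C])
    then show ?thesis
      using shift by (auto simp: dual_space_def add.commute)
  qed
  then have "(+) x0 ` P \<subseteq> (+) x0 ` rel_interior (V \<inter> C)"
    using app by (simp add: appropriate_def rel_interior_translation)
  then have PI: "P \<subseteq> rel_interior (V \<inter> C)"
    by (simp add: inj_image_subset_iff)
  have conv: "convex (V \<inter> C)"
    unfolding C_polar by (intro convex_Int subspace_imp_convex[OF subspace_V] convex_polar_cone)
  \<comment> \<open>The component of \<open>c\<close> in \<open>V\<close> has the same inner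
    products with the normals, which lie in \<open>V\<close>.\<close>
  obtain y z where yz: "y \<in> V" "z \<in> V\<^sup>\<bottom>" "c = y + z"
    using perp_decomp[OF subspace_V] by metis
  have yn: "0 < n \<bullet> y" if "n \<in> N" for n
  proof -
    have "n \<bullet> z = 0"
      using perp_inner[OF _ yz(2)] N_V that by blast
    then show ?thesis
      using c_pos[OF that] by (simp add: yz(3) inner_add_right)
  qed
  then have "y \<in> V \<inter> C"
    using yz(1) by (auto simp: C_def less_imp_le)
  then have y: "y \<in> affine hull (V \<inter> C)"
    by (rule hull_inc)
  show "P \<subseteq> reg"
  proof
    fix x assume "x \<in> P"
    then have "x \<in> rel_interior (V \<inter> C)"
      using PI by blast
    then obtain e where e: "1 < e" "(1 - e) *\<^sub>R y + e *\<^sub>R x \<in> V \<inter> C"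
      using convex_rel_interior_if2[OF conv] y by blast
    have "0 < n \<bullet> x" if n: "n \<in> N" for n
    proof -
      have "0 \<le> (1 - e) * (n \<bullet> y) + e * (n \<bullet> x)"
        using e(2) n by (simp add: C_def inner_add_right)
      moreover have "(1 - e) * (n \<bullet> y) < 0"
        using e(1) yn[OF n] by (simp add: mult_neg_pos)
      ultimately have "0 < e * (n \<bullet> x)"
        by simp
      then show ?thesis
        using e(1) by (simp add: zero_less_mult_iff)
    qed
    then show "x \<in> reg"
      by (simp add: reg_def)
  qed
qed

theorem theorem5p6:
  fixes V :: "'a::euclidean_space set" and x0 :: 'a
    and \<H> :: "'a set set set" and \<Phi> :: "'a set set" and P :: "'a set"
  assumes "subspace V" and "x0 \<in> V\<^sup>\<bottom>"
    and "finite \<H>" and "\<And>H. H \<in> \<H> \<Longrightarrow> linear_hyperplane V H"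
    and "is_singleton (qspace V \<inter> \<Inter>\<H>)"
    and "finite (refl_group V \<H>)"
    and "chamber V \<H> \<Phi>"
    and "\<And>g H. g \<in> refl_group V \<H> \<Longrightarrow> H \<in> \<H> \<Longrightarrow> g ` H \<inter> qrel_interior V \<Phi> = {}"
    and "polytope P" and "P \<subseteq> dual_space V x0"
    and "placed V x0 \<Phi> P" and "appropriate (dual_cone V x0 \<Phi>) P"
  shows "poset_isomorphic (GR V x0 \<H> \<Phi> P) (GR_le V \<H> \<Phi>)
           (normal_fan V x0 (symmetrization V x0 \<H> P)) (\<subseteq>)
       \<and> poset_isomorphic (nonempty_faces (symmetrization V x0 \<H> P)) (\<subseteq>)
           (GR V x0 \<H> \<Phi> P) (\<lambda>p q. GR_le V \<H> \<Phi> q p)"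
proof (cases "P = {}")
  \<comment> \<open>The empty polytope has no nonempty faces, so all posets involved are
    empty.\<close>
  case True
  have "GR V x0 \<H> \<Phi> P = {}"
    by (auto simp: True GR_def FFan_def normal_fan_def nonempty_faces_def)
  moreover have "symmetrization V x0 \<H> P = {}"
    by (simp add: True symmetrization_def)
  ultimately show ?thesis
    by (simp add: poset_isomorphic_def normal_fan_def nonempty_faces_def bij_betw_def)
next
  case False
  obtain \<nu> c where \<nu>': "\<forall>H\<in>\<H>. \<nu> H \<in> normals H \<and> norm (\<nu> H) = 1 \<and> 0 < \<nu> H \<bullet> c"
    and \<Phi>: "\<Phi> = quot_set V {x. \<forall>H\<in>\<H>. 0 \<le> \<nu> H \<bullet> x}"
    by (rule chamber_normals[OF assms(1,3,4,7)])
  have \<nu>: "\<nu> H \<in> normals H" "norm (\<nu> H) = 1" "0 < \<nu> H \<bullet> c" if "H \<in> \<H>" for H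
    using \<nu>' that by auto
  note hyp = linear_hyperplane_normals[OF assms(1,4)]
  let ?N = "\<nu> ` \<H>"
  have NV: "?N \<subseteq> V"
    using hyp(3) \<nu>(1) by blast
  have "reflection V H = quot_act V (hrefl (\<nu> H))" if H: "H \<in> \<H>" for H
    by (rule reflection_eq[OF \<nu>(1)[OF H]]) (rule hyp(4)[OF H \<nu>(1)[OF H]])
  then have group: "refl_group V \<H> = quot_act V ` hrefl_word ` lists ?N"
    by (rule refl_group_eq[OF NV])
  have fix_word: "perp_fixing V g" if "g \<in> hrefl_word ` lists ?N" for g
    using that perp_fixing_hrefl_word[OF _ NV] by blast
  have Phi: "\<Phi> = quot_set V (polar_cone ?N)"
    by (simp add: \<Phi> polar_cone_def)
  have sat: "saturated V (polar_cone ?N)"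
    by (rule saturated_polar_cone[OF NV])
  interpret quotient_reflections ?N c V
  proof unfold_locales
    show "finite ?N" "subspace V" "?N \<subseteq> V"
      using assms NV by auto
    show "norm n = 1" "0 < n \<bullet> c" if "n \<in> ?N" for n
      using that \<nu> by auto
    show "finite (hrefl_word ` lists ?N)"
    proof (rule finite_imageD)
      show "finite (quot_act V ` hrefl_word ` lists ?N)"
        using assms(6) by (simp add: group)
      show "inj_on (quot_act V) (hrefl_word ` lists ?N)"
        by (rule inj_onI) (use quot_act_inj[OF assms(1)] fix_word in blast)
    qed
    \<comment> \<open>A zero would put the class of \<open>x\<close> both on the image under
      \<open>g\<close> of the hyperplane of \<open>n\<close> and in the interior of \<Phi>, which
      the hypothesis on images of hyperplanes excludes.\<close>
    show "g n \<bullet> x \<noteq> 0" if g: "g \<in> hrefl_word ` lists ?N" and n: "n \<in> ?N"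
      and x: "\<And>m. m \<in> ?N \<Longrightarrow> 0 < m \<bullet> x" for g n x
    proof
      assume 0: "g n \<bullet> x = 0"
      obtain H where H: "H \<in> \<H>" "n = \<nu> H"
        using n by blast
      have "surj g"
        using fix_word[OF g] orthogonal_transformation_surj by (auto simp: perp_fixing_def)
      then obtain y where y: "x = g y"
        by (rule surjE)
      have "n \<bullet> y = 0"
        using 0 perp_fixing_inner[OF fix_word[OF g]] by (simp add: y)
      then have "y \<in> \<Union>H"
        using hyp(2)[OF H(1) \<nu>(1)[OF H(1)]] H(2) by simp
      then have "qclass V y \<in> H"
        using assms(4)[OF H(1)] qclass_mem_iff[of H V y] by (simp add: linear_hyperplane_def)
      then have 1: "qclass V x \<in> quot_act V g ` H"
        using quot_act_qclass[OF fix_word[OF g], of y] by (auto simp: y image_iff)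
      \<comment> \<open>Openness places \<open>U\<close> in the relative interior of the preimage of
        \<Phi>; invariance under \<open>V\<^sup>\<bottom>\<close> places the whole coset of
        \<open>x\<close> there, as \<open>qrel_interior\<close> demands.\<close>
      define U where "U = (\<Inter>n\<in>?N. {x. n \<bullet> x > 0})"
      have "open U"
        using assms(3) by (simp add: U_def open_INT open_halfspace_gt)
      moreover have "U \<subseteq> polar_cone ?N"
        by (auto simp: U_def polar_cone_def less_imp_le)
      ultimately have U: "U \<subseteq> rel_interior (polar_cone ?N)"
        using interior_maximal interior_subset_rel_interior by blast
      have "qclass V x \<subseteq> U"
      proof
        fix t assume "t \<in> qclass V x"
        then have "n \<bullet> (t - x) = 0" if "n \<in> ?N" for n
          using perp_inner[of n V "t - x"] NV that by (auto simp: qclass_iff)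
        then show "t \<in> U"
          using x by (auto simp: U_def inner_diff_right)
      qed
      then have "qclass V x \<in> qrel_interior V \<Phi>"
        using U by (auto simp: qrel_interior_def qclass_qspace Phi Union_quot_set[OF sat])
      moreover have "quot_act V g \<in> refl_group V \<H>"
        using g by (simp add: group)
      ultimately show False
        using assms(8)[OF _ H(1)] 1 by blast
    qed
  qed
  have PhiC: "\<Phi> = quot_set V C"
    by (simp add: Phi C_def polar_cone_def)
  have groupG: "refl_group V \<H> = quot_act V ` G"
    by (simp add: group G_def)
  define P0 where "P0 = (+) (- x0) ` P"
  have P: "P = (+) x0 ` P0"
    by (simp add: P0_def image_image)
  have P0: "polytope P0" "P0 \<noteq> {}"
    unfolding P0_def polytope_translation_eq using assms(9) False by auto
  have P0': "P0 \<subseteq> V" "P0 \<subseteq> reg"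
    using appropriate_reg[OF assms(2) assms(10)[unfolded P] assms(12)[unfolded P PhiC]] .
  have sym: "symmetrization V x0 \<H> P = (+) x0 ` sym_hull P0"
    unfolding P by (rule symmetrization_eq[OF P0'(1) groupG])
  have iso: "poset_isomorphic (GR V x0 \<H> \<Phi> P) (GR_le V \<H> \<Phi>)
      (normal_fan V x0 (symmetrization V x0 \<H> P)) (\<subseteq>)"
    unfolding sym unfolding PhiC P by (rule GR_isomorphic_normal_fan[OF P0 P0' groupG])
  have "sym_hull P0 \<subseteq> V"
    unfolding sym_hull_def using G_mem_V P0'(1)
    by (intro hull_minimal subspace_imp_convex[OF subspace_V]) auto
  then have "poset_isomorphic (nonempty_faces (symmetrization V x0 \<H> P)) (\<subseteq>)
      (normal_fan V x0 (symmetrization V x0 \<H> P)) (\<lambda>x y. y \<subseteq> x)"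
    unfolding sym by (rule faces_isomorphic_normal_fan[OF polytope_sym_hull[OF P0(1)]])
  then have "poset_isomorphic (nonempty_faces (symmetrization V x0 \<H> P)) (\<subseteq>)
      (GR V x0 \<H> \<Phi> P) (\<lambda>p q. GR_le V \<H> \<Phi> q p)"
    by (rule poset_isomorphic_trans[OF _ poset_isomorphic_sym[OF poset_isomorphic_dual[OF iso]]])
  with iso show ?thesis ..
qed

end
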